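(* Let $\delta\ge0$. The group $G=\mathrm{Aut}(\mathbb{H}_\delta)=\mathrm{Isom}(\mathbb{H}_\delta)$ has no dense conjugacy class. For any finite nonempty set $B\subset\mathbb{H}_\delta$, the pointwise stabilizer $G_{\mathrm{cl}(B)}$ of $\mathrm{cl}(B)$ in $G$ has a dense conjugacy class.
   Context: A metric space $(X,d)$ is $\delta$-hyperbolic if for all $x_1,\dots,x_4\in X$ one has $d(x_1,x_4)+d(x_2,x_3)\le\max\{d(x_1,x_2)+d(x_3,x_4),\,d(x_1,x_3)+d(x_2,x_4)\}+2\delta$. A subset $A$ of a metric space $X$ is gated in $X$ if for every $b\in X\setminus A$ there is a (necessarily unique) gate $g_A(b)\in A$ such that $d(b,a)=d(b,g_A(b))+d(g_A(b),a)$ for all $a\in A$. A nonempty $A\subseteq X$ is $\delta$-closed in $X$ if $A$ is gated in $X$ and for all $b,b'\in X\setminus A$ with $d(g_A(b),g_A(b'))>\delta$ we have $d(b,b')=d(b,g_A(b))+d(g_A(b),g_A(b'))+d(g_A(b'),b')$. $\mathbb{H}_\delta$ denotes the countable $\delta$-hyperbolic metric space with rational distances, unique up to isometry, such that: it is the union of a countable chain of finite $\delta$-closed subsets; every finite $\delta$-hyperbolic metric space with rational distances is isometric to a $\delta$-closed subset of $\mathbb{H}_\delta$; and every isometry between finite $\delta$-closed subsets of $\mathbb{H}_\delta$ extends to an isometry of $\mathbb{H}_\delta$ onto itself. For a finite nonempty $B\subset\mathbb{H}_\delta$, $\mathrm{cl}(B)$ is the smallest $\delta$-closed subset of $\mathbb{H}_\delta$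 containing $B$, i.e. the intersection of all $\delta$-closed subsets containing $B$. $G$ is a Polish group with the topology in which a neighbourhood basis of the identity is given by the pointwise stabilizers of finite $\delta$-closed subsets of $\mathbb{H}_\delta$; subgroups carry the subspace topology. *)

theory Defs
  imports "HOL-Analysis.Analysis" "HOL-Algebra.Coset" "HOL-Algebra.Bij"
begin

section \<open>Hyperbolic spaces, gated sets and \<open>\<delta>\<close>-closed sets\<close>

definition hyperbolic :: "real \<Rightarrow> 'a set \<Rightarrow> ('a \<Rightarrow> 'a \<Rightarrow> real) \<Rightarrow> bool" where
  "hyperbolic \<delta> M d \<longleftrightarrow>
     (\<forall>x1\<in>M. \<forall>x2\<in>M. \<forall>x3\<in>M. \<forall>x4\<in>M.
        d x1 x4 + d x2 x3 \<le> max (d x1 x2 + d x3 x4) (d x1 x3 + d x2 x4) + 2 * \<delta>)"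

definition is_gate :: "('a \<Rightarrow> 'a \<Rightarrow> real) \<Rightarrow> 'a set \<Rightarrow> 'a \<Rightarrow> 'a \<Rightarrow> bool" where
  "is_gate d A b g \<longleftrightarrow> g \<in> A \<and> (\<forall>a\<in>A. d b a = d b g + d g a)"

definition gate :: "('a \<Rightarrow> 'a \<Rightarrow> real) \<Rightarrow> 'a set \<Rightarrow> 'a \<Rightarrow> 'a" where
  "gate d A b = (THE g. is_gate d A b g)"

definition gated :: "'a set \<Rightarrow> ('a \<Rightarrow> 'a \<Rightarrow> real) \<Rightarrow> 'a set \<Rightarrow> bool" where
  "gated M d A \<longleftrightarrow> A \<subseteq> M \<and> (\<forall>b\<in>M - A. \<exists>g. is_gate d A b g)"

definition delta_closed :: "real \<Rightarrow> 'a set \<Rightarrow> ('a \<Rightarrow> 'a \<Rightarrow> real) \<Rightarrow> 'a set \<Rightarrow> bool" where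
  "delta_closed \<delta> M d A \<longleftrightarrow>
     A \<noteq> {} \<and> gated M d A \<and>
     (\<forall>b\<in>M - A. \<forall>b'\<in>M - A. d (gate d A b) (gate d A b') > \<delta> \<longrightarrow>
        d b b' = d b (gate d A b) + d (gate d A b) (gate d A b') + d (gate d A b') b')"

definition delta_cl :: "real \<Rightarrow> 'a set \<Rightarrow> ('a \<Rightarrow> 'a \<Rightarrow> real) \<Rightarrow> 'a set \<Rightarrow> 'a set" where
  "delta_cl \<delta> M d B = \<Inter>{A. delta_closed \<delta> M d A \<and> B \<subseteq> A}"

lemma (in Metric_space) is_gate_unique:
  assumes "A \<subseteq> M" "is_gate d A b g" "is_gate d A b g'"
  shows "g = g'"
proof -
  have "g \<in> A" "g' \<in> A" "d b g' = d b g + d g g'" "d b g = d b g' + d g' g"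
    using assms(2,3) unfolding is_gate_def by blast+
  then have "d g g' = 0" using nonneg[of g g'] nonneg[of g' g] by linarith
  with zero[of g g'] \<open>g \<in> A\<close> \<open>g' \<in> A\<close> assms(1) show ?thesis by blast
qed

lemma (in Metric_space) gate_eq:
  "A \<subseteq> M \<Longrightarrow> is_gate d A b g \<Longrightarrow> gate d A b = g"
  unfolding gate_def by (rule the_equality) (blast intro: is_gate_unique)+

section \<open>The space \<open>\<bbbH>\<^sub>\<delta>\<close>\<close>

definition isometric_on :: "'a set \<Rightarrow> ('a \<Rightarrow> 'a \<Rightarrow> real) \<Rightarrow> ('b \<Rightarrow> 'b \<Rightarrow> real) \<Rightarrow> ('a \<Rightarrow> 'b) \<Rightarrow> bool" where
  "isometric_on M d e f \<longleftrightarrow> (\<forall>x\<in>M. \<forall>y\<in>M. e (f x) (f y) = d x y)"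

definition rational_distances :: "'a set \<Rightarrow> ('a \<Rightarrow> 'a \<Rightarrow> real) \<Rightarrow> bool" where
  "rational_distances M d \<longleftrightarrow> (\<forall>x\<in>M. \<forall>y\<in>M. d x y \<in> \<rat>)"

text \<open>
  The space is determined only up to isometry, so it is represented by its defining properties.
  In the universality clause, finite metric spaces are taken on subsets of \<^typ>\<open>nat\<close>, which covers all
  of them up to isometry; they must be nonempty, because \<open>\<delta>\<close>-closed sets are.
\<close>

definition is_H_delta :: "real \<Rightarrow> 'a set \<Rightarrow> ('a \<Rightarrow> 'a \<Rightarrow> real) \<Rightarrow> bool" where
  "is_H_delta \<delta> H d \<longleftrightarrow>
     Metric_space H d \<and> countable H \<and> hyperbolic \<delta> H d \<and> rational_distances H d \<and>
     (\<exists>C :: nat \<Rightarrow> 'a set. incseq C \<and> (\<forall>n. finite (C n) \<and> delta_closed \<delta> H d (C n)) \<and> (\<Union>n. C n) = H) \<and>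
     (\<forall>(N :: nat set) e.
        Metric_space N e \<and> finite N \<and> N \<noteq> {} \<and> hyperbolic \<delta> N e \<and> rational_distances N e \<longrightarrow>
        (\<exists>f. f ` N \<subseteq> H \<and> isometric_on N e d f \<and> delta_closed \<delta> H d (f ` N))) \<and>
     (\<forall>A A' f.
        finite A \<and> delta_closed \<delta> H d A \<and> finite A' \<and> delta_closed \<delta> H d A' \<and>
        bij_betw f A A' \<and> isometric_on A d d f \<longrightarrow>
        (\<exists>g. bij_betw g H H \<and> isometric_on H d d g \<and> (\<forall>a\<in>A. g a = f a)))"

section \<open>The isometry group and its topology\<close>

definition isom_group :: "'a set \<Rightarrow> ('a \<Rightarrow> 'a \<Rightarrow> real) \<Rightarrow> ('a \<Rightarrow> 'a) monoid" where
  "isom_group M d = BijGroup M \<lparr>carrier := {f \<in> Bij M. isometric_on M d d f}\<rparr>"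

definition pointwise_stabilizer :: "'a set \<Rightarrow> ('a \<Rightarrow> 'a \<Rightarrow> real) \<Rightarrow> 'a set \<Rightarrow> ('a \<Rightarrow> 'a) set" where
  "pointwise_stabilizer M d A = {g \<in> carrier (isom_group M d). \<forall>a\<in>A. g a = a}"

text \<open>
  A group topology is determined by a neighbourhood basis of the identity through translation:
  it is generated by the left cosets of the stabilizers. By \<open>openin_isom_topology\<close> below, these
  cosets form a basis when the space is \<open>\<bbbH>\<^sub>\<delta>\<close>.
\<close>

definition isom_topology :: "real \<Rightarrow> 'a set \<Rightarrow> ('a \<Rightarrow> 'a \<Rightarrow> real) \<Rightarrow> ('a \<Rightarrow> 'a) topology" where
  "isom_topology \<delta> M d = topology_generated_by
     {g <#\<^bsub>isom_group M d\<^esub> pointwise_stabilizer M d A | g A.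
        g \<in> carrier (isom_group M d) \<and> finite A \<and> delta_closed \<delta> M d A}"

definition conjugacy_class :: "('a, 'b) monoid_scheme \<Rightarrow> 'a \<Rightarrow> 'a set" where
  "conjugacy_class G g = {k \<otimes>\<^bsub>G\<^esub> g \<otimes>\<^bsub>G\<^esub> inv\<^bsub>G\<^esub> k | k. k \<in> carrier G}"

definition has_dense_conjugacy_class :: "('a, 'b) monoid_scheme \<Rightarrow> 'a topology \<Rightarrow> bool" where
  "has_dense_conjugacy_class G T \<longleftrightarrow>
     (\<exists>g\<in>carrier G. T closure_of conjugacy_class G g = carrier G)"

lemma subgroup_isom: "subgroup {f \<in> Bij M. isometric_on M d d f} (BijGroup M)"
proof (rule group.subgroupI[OF group_BijGroup])
  show "{f \<in> Bij M. isometric_on M d d f} \<subseteq> carrier (BijGroup M)"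
    by (auto simp: BijGroup_def)
  have "(\<lambda>x\<in>M. x) \<in> {f \<in> Bij M. isometric_on M d d f}"
    by (auto simp: id_Bij isometric_on_def)
  then show "{f \<in> Bij M. isometric_on M d d f} \<noteq> {}" by blast
next
  fix f assume f: "f \<in> {f \<in> Bij M. isometric_on M d d f}"
  then have b: "bij_betw f M M" and i: "isometric_on M d d f" by (auto simp: Bij_def)
  have "isometric_on M d d (restrict (inv_into M f) M)"
    unfolding isometric_on_def
  proof (intro ballI)
    fix x y assume "x \<in> M" "y \<in> M"
    moreover from this have "inv_into M f x \<in> M" "inv_into M f y \<in> M"
        "f (inv_into M f x) = x" "f (inv_into M f y) = y"
      using b by (auto simp: bij_betw_def inv_into_into f_inv_into_f)
    ultimately show "d (restrict (inv_into M f) M x) (restrict (inv_into M f) M y) = d x y"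
      using i unfolding isometric_on_def by (metis restrict_apply')
  qed
  then show "inv\<^bsub>BijGroup M\<^esub> f \<in> {f \<in> Bij M. isometric_on M d d f}"
    using f by (simp add: inv_BijGroup restrict_inv_into_Bij)
next
  fix f g assume "f \<in> {f \<in> Bij M. isometric_on M d d f}" "g \<in> {f \<in> Bij M. isometric_on M d d f}"
  then show "f \<otimes>\<^bsub>BijGroup M\<^esub> g \<in> {f \<in> Bij M. isometric_on M d d f}"
    using Bij_imp_funcset[of g M] compose_Bij[of f M g]
    by (auto simp: BijGroup_def isometric_on_def compose_def Pi_iff)
qed

lemma group_isom_group: "group (isom_group M d)"
  unfolding isom_group_def
  by (rule group.subgroup_imp_group[OF group_BijGroup subgroup_isom])

lemma carrier_isom_group: "carrier (isom_group M d) = {f \<in> Bij M. isometric_on M d d f}"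
  by (simp add: isom_group_def)

lemma mult_isom_group:
  assumes "f \<in> carrier (isom_group M d)" "g \<in> carrier (isom_group M d)" "x \<in> M"
  shows "(f \<otimes>\<^bsub>isom_group M d\<^esub> g) x = f (g x)"
  using assms by (simp add: isom_group_def BijGroup_def compose_def)

lemma subgroup_pointwise_stabilizer:
  assumes "A \<subseteq> M"
  shows "subgroup (pointwise_stabilizer M d A) (isom_group M d)"
proof -
  interpret group "isom_group M d" by (rule group_isom_group)
  have one: "\<one>\<^bsub>isom_group M d\<^esub> x = x" if "x \<in> M" for x
    using that by (simp add: isom_group_def BijGroup_def)
  show ?thesis
  proof (rule subgroupI)
    show "pointwise_stabilizer M d A \<noteq> {}"
      using one assms one_closed by (auto simp: pointwise_stabilizer_def subset_iff)
  next
    fix f assume "f \<in> pointwise_stabilizer M d A"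
    then have f: "f \<in> carrier (isom_group M d)" "\<forall>a\<in>A. f a = a"
      by (auto simp: pointwise_stabilizer_def)
    have "(inv\<^bsub>isom_group M d\<^esub> f) a = a" if "a \<in> A" for a
      using mult_isom_group[OF inv_closed[OF f(1)] f(1), of a] f one[of a] that assms l_inv[OF f(1)]
      by (auto simp: subset_iff)
    then show "inv\<^bsub>isom_group M d\<^esub> f \<in> pointwise_stabilizer M d A"
      using f by (simp add: pointwise_stabilizer_def)
  next
    fix f g assume "f \<in> pointwise_stabilizer M d A" "g \<in> pointwise_stabilizer M d A"
    then show "f \<otimes>\<^bsub>isom_group M d\<^esub> g \<in> pointwise_stabilizer M d A"
      using assms by (auto simp: pointwise_stabilizer_def mult_isom_group subset_iff)
  qed (auto simp: pointwise_stabilizer_def)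
qed

lemma coset_pointwise_stabilizer:
  assumes "A \<subseteq> M" "g \<in> carrier (isom_group M d)"
  shows "g <#\<^bsub>isom_group M d\<^esub> pointwise_stabilizer M d A =
         {h \<in> carrier (isom_group M d). \<forall>a\<in>A. h a = g a}" (is "?L = ?R")
proof -
  interpret group "isom_group M d" by (rule group_isom_group)
  let ?G = "isom_group M d"
  have one: "\<one>\<^bsub>?G\<^esub> x = x" if "x \<in> M" for x
    using that by (simp add: isom_group_def BijGroup_def)
  show ?thesis
  proof (intro equalityI subsetI)
    fix h assume "h \<in> ?L"
    then show "h \<in> ?R"
      using assms by (auto simp: l_coset_def pointwise_stabilizer_def mult_isom_group subset_iff)
  next
    fix h assume "h \<in> ?R"
    then have h: "h \<in> carrier ?G" "\<forall>a\<in>A. h a = g a" by auto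
    let ?k = "inv\<^bsub>?G\<^esub> g \<otimes>\<^bsub>?G\<^esub> h"
    have "?k a = a" if "a \<in> A" for a
    proof -
      have "a \<in> M" using that assms by auto
      then show ?thesis
        using mult_isom_group[OF inv_closed[OF assms(2)] h(1), of a] h(2) that l_inv[OF assms(2)]
          one[of a] mult_isom_group[OF inv_closed[OF assms(2)] assms(2), of a] by simp
    qed
    then have "?k \<in> pointwise_stabilizer M d A"
      using assms h by (auto simp: pointwise_stabilizer_def)
    moreover have "h = g \<otimes>\<^bsub>?G\<^esub> ?k"
      using assms h by (simp add: m_assoc[symmetric])
    ultimately show "h \<in> ?L" by (auto simp: l_coset_def)
  qed
qed

lemma openin_isom_topology:
  assumes "is_H_delta \<delta> H d"
  shows "openin (isom_topology \<delta> H d) U \<longleftrightarrow>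
           U \<subseteq> carrier (isom_group H d) \<and>
           (\<forall>g\<in>U. \<exists>A. finite A \<and> delta_closed \<delta> H d A \<and>
              g <#\<^bsub>isom_group H d\<^esub> pointwise_stabilizer H d A \<subseteq> U)" (is "_ \<longleftrightarrow> ?P U")
proof
  let ?G = "isom_group H d" and ?S = "pointwise_stabilizer H d"
  let ?W = "\<lambda>g A. {h \<in> carrier ?G. \<forall>a\<in>A. h a = g a}"
  have "\<exists>C :: nat \<Rightarrow> 'a set. incseq C \<and> (\<forall>n. finite (C n) \<and> delta_closed \<delta> H d (C n)) \<and> (\<Union>n. C n) = H"
    using assms by (simp only: is_H_delta_def)
  then obtain C :: "nat \<Rightarrow> 'a set" where C: "incseq C" "\<And>n. finite (C n)"
      "\<And>n. delta_closed \<delta> H d (C n)" "(\<Union>n. C n) = H"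
    by blast
  have sub: "A \<subseteq> H" if "delta_closed \<delta> H d A" for A
    using that by (auto simp: delta_closed_def gated_def)
  have fin: "\<exists>n. F \<subseteq> C n" if "finite F" "F \<subseteq> H" for F
    using that
  proof (induction F)
    case (insert x F)
    then obtain n m where "F \<subseteq> C n" "x \<in> C m" using C(4) by auto
    then have "insert x F \<subseteq> C (max n m)"
      using incseqD[OF C(1), of n "max n m"] incseqD[OF C(1), of m "max n m"] by auto
    then show ?case by blast
  qed simp
  have coset: "g <#\<^bsub>?G\<^esub> ?S A = ?W g A" if "g \<in> carrier ?G" "delta_closed \<delta> H d A" for g A
    by (rule coset_pointwise_stabilizer[OF sub[OF that(2)] that(1)])
  {
    assume "openin (isom_topology \<delta> H d) U"
    then have "generate_topology_on {g <#\<^bsub>?G\<^esub> ?S A | g A.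
        g \<in> carrier ?G \<and> finite A \<and> delta_closed \<delta> H d A} U"
      unfolding isom_topology_def by (rule openin_topology_generated_by)
    then show "?P U"
    proof (induction rule: generate_topology_on.induct)
      case Empty
      then show ?case by simp
    next
      case (Int U V)
      show ?case
      proof (intro conjI ballI)
        show "U \<inter> V \<subseteq> carrier ?G" using Int by blast
        fix g assume g: "g \<in> U \<inter> V"
        obtain A where A: "finite A" "delta_closed \<delta> H d A" "g <#\<^bsub>?G\<^esub> ?S A \<subseteq> U"
          using Int.IH(1) g by blast
        obtain B where B: "finite B" "delta_closed \<delta> H d B" "g <#\<^bsub>?G\<^esub> ?S B \<subseteq> V"
          using Int.IH(2) g by blast
        note AB = A B
        have gc: "g \<in> carrier ?G" using g Int by blast
        obtain n where n: "A \<union> B \<subseteq> C n" using fin[of "A \<union> B"] AB sub by blast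
        have "?W g (C n) \<subseteq> ?W g A \<inter> ?W g B" using n by auto
        then have "g <#\<^bsub>?G\<^esub> ?S (C n) \<subseteq> U \<inter> V"
          using AB(3,6) unfolding coset[OF gc AB(2)] coset[OF gc AB(5)] coset[OF gc C(3)] by blast
        then show "\<exists>A. finite A \<and> delta_closed \<delta> H d A \<and> g <#\<^bsub>?G\<^esub> ?S A \<subseteq> U \<inter> V"
          using C by blast
      qed
    next
      case (UN K)
      show ?case
      proof (intro conjI ballI)
        show "\<Union>K \<subseteq> carrier ?G" using UN.IH by blast
        fix g assume "g \<in> \<Union>K"
        then obtain k where k: "k \<in> K" "g \<in> k" by blast
        with UN.IH obtain A where "finite A" "delta_closed \<delta> H d A" "g <#\<^bsub>?G\<^esub> ?S A \<subseteq> k" by meson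
        with k show "\<exists>A. finite A \<and> delta_closed \<delta> H d A \<and> g <#\<^bsub>?G\<^esub> ?S A \<subseteq> \<Union>K" by blast
      qed
    next
      case (Basis s)
      then obtain g A where s: "s = g <#\<^bsub>?G\<^esub> ?S A" "g \<in> carrier ?G" "finite A" "delta_closed \<delta> H d A"
        by blast
      then have sW: "s = ?W g A" using coset by simp
      show ?case
      proof (intro conjI ballI exI[of _ A])
        show "s \<subseteq> carrier ?G" using sW by auto
        fix h assume h: "h \<in> s"
        then have hc: "h \<in> carrier ?G" and hg: "\<forall>a\<in>A. h a = g a" using sW by blast+
        show "h <#\<^bsub>?G\<^esub> ?S A \<subseteq> s"
          unfolding coset[OF hc s(4)] sW using hg by (intro subsetI CollectI conjI ballI) simp_all
      qed (use s in blast)+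
    qed
  next
    assume P: "?P U"
    let ?B = "{g <#\<^bsub>?G\<^esub> ?S A | g A. g \<in> carrier ?G \<and> finite A \<and> delta_closed \<delta> H d A}"
    have "U = \<Union>{V \<in> ?B. V \<subseteq> U}"
    proof (intro equalityI subsetI)
      fix g assume g: "g \<in> U"
      then obtain A where A: "finite A" "delta_closed \<delta> H d A" "g <#\<^bsub>?G\<^esub> ?S A \<subseteq> U"
        using P by blast
      have gc: "g \<in> carrier ?G" using P g by blast
      then have "g \<in> g <#\<^bsub>?G\<^esub> ?S A" using coset A by simp
      then show "g \<in> \<Union>{V \<in> ?B. V \<subseteq> U}" using A gc by blast
    qed blast
    moreover have "generate_topology_on ?B (\<Union>{V \<in> ?B. V \<subseteq> U})"
      by (rule generate_topology_on.UN) (auto intro: generate_topology_on.Basis)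
    ultimately show "openin (isom_topology \<delta> H d) U"
      unfolding isom_topology_def openin_topology_generated_by_iff by simp
  }
qed

end

theory Submission
  imports Defs
begin

text \<open>
  Points are \<open>\<delta>\<close>-closed, so an isometry with dense conjugacy class would fix a point; it would also be
  conjugate to one moving \<open>p\<^sub>0\<close> to \<open>p\<^sub>1\<close> and \<open>p\<^sub>1\<close> to \<open>p\<^sub>2\<close> along a geodesic with steps longer
  than \<open>2\<delta>\<close>, and the four point condition forbids fixed points of such an isometry.

  For the stabilizer of a finite \<open>\<delta>\<close>-closed set \<open>A\<close>, two copies of a finite \<open>\<delta>\<close>-closed \<open>F \<supseteq> A\<close> are glued
  along \<open>A\<close>, with distances across running through the gates. The amalgam is again \<open>\<delta>\<close>-hyperbolic
  with both copies \<open>\<delta>\<close>-closed, so some \<open>k\<close> fixing \<open>A\<close> makes \<open>F\<close> and \<open>k F\<close> such a pair inside the space.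
  Then any \<open>g\<close> on a \<open>\<delta>\<close>-closed part of \<open>F\<close> and any \<open>k g' k\<^sup>-\<^sup>1\<close> on the corresponding part of \<open>k F\<close> have a
  common extension. Iterating over a countable dense set of \<open>g'\<close> yields an element of the stabilizer
  whose conjugates agree with every \<open>g'\<close> on every finite set.
\<close>

section \<open>Closed sets\<close>

text \<open>Gates are determined by \<open>A\<close> and \<open>d\<close> alone, so shrinking the
  ambient space leaves the gate map as it is.\<close>

lemma delta_closed_subset:
  assumes "delta_closed \<delta> M d A" "A \<subseteq> N" "N \<subseteq> M"
  shows "delta_closed \<delta> N d A"
  using assms unfolding delta_closed_def gated_def by blast

context Metric_space
begin

lemma is_gate_self:
  assumes "a \<in> A" "A \<subseteq> M"
  shows "is_gate d A a a"
  using assms by (auto simp: is_gate_def)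

text \<open>Recognises a closed set from an explicit candidate for the gate map, which uniqueness of
  gates identifies with \<open>gate d A\<close>. The conditions range over all of \<open>M\<close>,
  so that applications need not separate the points of \<open>A\<close>.\<close>

lemma delta_closedI:
  assumes "A \<subseteq> M" "A \<noteq> {}" and g: "\<And>b. b \<in> M \<Longrightarrow> is_gate d A b (g b)"
    and far: "\<And>b b'. b \<in> M \<Longrightarrow> b' \<in> M \<Longrightarrow> \<delta> < d (g b) (g b') \<Longrightarrow>
      d b b' = d b (g b) + d (g b) (g b') + d (g b') b'"
  shows "delta_closed \<delta> M d A"
proof -
  have "gate d A b = g b" if "b \<in> M" for b
    using gate_eq[OF assms(1) g[OF that]] .
  then show ?thesis
    unfolding delta_closed_def gated_def using assms by (metis DiffD1)
qed

lemma is_gate_gate: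
  assumes "delta_closed \<delta> M d A" "b \<in> M"
  shows "is_gate d A b (gate d A b)"
proof -
  have A: "A \<subseteq> M" using assms(1) by (simp add: delta_closed_def gated_def)
  obtain g where "is_gate d A b g"
    using assms is_gate_self[OF _ A] unfolding delta_closed_def gated_def by blast
  with gate_eq[OF A] show ?thesis by simp
qed

lemma gate_self:
  assumes "a \<in> A" "A \<subseteq> M"
  shows "gate d A a = a"
  using assms gate_eq is_gate_self by blast

lemma gate_in:
  assumes "delta_closed \<delta> M d A" "b \<in> M"
  shows "gate d A b \<in> A" "gate d A b \<in> M"
  using is_gate_gate[OF assms] assms(1) unfolding is_gate_def delta_closed_def gated_def by blast+

lemma dist_gate:
  assumes "delta_closed \<delta> M d A" "b \<in> M" "a \<in> A"
  shows "d b a = d b (gate d A b) + d (gate d A b) a"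
  using is_gate_gate[OF assms(1,2)] assms(3) unfolding is_gate_def by blast

text \<open>Extends the defining clause to points of \<open>A\<close>: such a point is its own gate,
  and additivity becomes the gate property of the other point.\<close>

lemma dist_far_gates:
  assumes cl: "delta_closed \<delta> M d A" and b: "b \<in> M" "b' \<in> M"
    and far: "\<delta> < d (gate d A b) (gate d A b')"
  shows "d b b' = d b (gate d A b) + d (gate d A b) (gate d A b') + d (gate d A b') b'"
proof -
  have A: "A \<subseteq> M" using cl by (simp add: delta_closed_def gated_def)
  consider "b \<in> A" | "b' \<in> A" | "b \<in> M - A" "b' \<in> M - A" using b by blast
  then show ?thesis
  proof cases
    case 1
    then show ?thesis
      using dist_gate[OF cl b(2) 1] commute[of b' b] commute[of "gate d A b'" b]
        commute[of b' "gate d A b'"] b unfolding gate_self[OF 1 A] by simp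
  next
    case 2
    then show ?thesis
      using dist_gate[OF cl b(1) 2] b unfolding gate_self[OF 2 A] by simp
  next
    case 3
    then show ?thesis using cl far unfolding delta_closed_def by blast
  qed
qed

lemma delta_closed_whole:
  assumes "M \<noteq> {}"
  shows "delta_closed \<delta> M d M"
  by (rule delta_closedI[where g = "\<lambda>x. x"]) (use assms in \<open>auto simp: is_gate_def\<close>)

lemma delta_closed_singleton:
  assumes "a \<in> M" "\<delta> \<ge> 0"
  shows "delta_closed \<delta> M d {a}"
  by (rule delta_closedI[where g = "\<lambda>x. a"]) (use assms in \<open>auto simp: is_gate_def\<close>)

text \<open>The gate map onto \<open>A\<close> is the composite of the gate maps onto
  \<open>X\<close> and then \<open>A\<close>. Far gates in \<open>A\<close> force far gates in
  \<open>X\<close>, because the distance between the latter splits through the former; so the two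
  far clauses chain.\<close>

lemma delta_closed_trans:
  assumes X: "delta_closed \<delta> M d X" and A: "delta_closed \<delta> X d A"
  shows "delta_closed \<delta> M d A"
proof -
  have XM: "X \<subseteq> M" using X by (simp add: delta_closed_def gated_def)
  interpret X: Metric_space X d by (rule subspace[OF XM])
  have AX: "A \<subseteq> X" "A \<noteq> {}" using A by (auto simp: delta_closed_def gated_def)
  let ?p = "gate d X" and ?q = "\<lambda>b. gate d A (gate d X b)"
  have p: "?p b \<in> X" "?p b \<in> M" if "b \<in> M" for b using gate_in[OF X that] by auto
  have q: "?q b \<in> A" "?q b \<in> X" "?q b \<in> M" if "b \<in> M" for b
    using X.gate_in[OF A p(1)[OF that]] AX XM by auto
  have dq: "d b (?q b) = d b (?p b) + d (?p b) (?q b)" if "b \<in> M" for b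
    using dist_gate[OF X that q(2)[OF that]] .
  show ?thesis
  proof (rule delta_closedI[where g = ?q])
    show "A \<subseteq> M" "A \<noteq> {}" using AX XM by auto
    show "is_gate d A b (?q b)" if b: "b \<in> M" for b
      unfolding is_gate_def
    proof (intro conjI ballI)
      fix a assume a: "a \<in> A"
      then have "d b a = d b (?p b) + d (?p b) a" "d (?p b) a = d (?p b) (?q b) + d (?q b) a"
        using dist_gate[OF X b] X.dist_gate[OF A p(1)[OF b] a] AX by auto
      with dq[OF b] show "d b a = d b (?q b) + d (?q b) a" by simp
    qed (rule q[OF b])
    fix b b' assume b: "b \<in> M" "b' \<in> M" and far: "\<delta> < d (?q b) (?q b')"
    have 1: "d (?p b) (?p b') = d (?p b) (?q b) + d (?q b) (?q b') + d (?q b') (?p b')"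
      by (rule X.dist_far_gates[OF A p(1)[OF b(1)] p(1)[OF b(2)] far])
    with far have "\<delta> < d (?p b) (?p b')"
      using nonneg[of "?p b" "?q b"] nonneg[of "?q b'" "?p b'"] by linarith
    then have "d b b' = d b (?p b) + d (?p b) (?p b') + d (?p b') b'"
      by (rule dist_far_gates[OF X b])
    then show "d b b' = d b (?q b) + d (?q b) (?q b') + d (?q b') b'"
      using 1 dq[OF b(1)] dq[OF b(2)] by (simp add: commute)
  qed
qed

text \<open>Going back and forth between the sets, \<open>q\<close> is the gate of \<open>p\<close>,
  and \<open>p\<close> turns out to be the gate of \<open>q\<close>. Seen from either of the two,
  the common point \<open>c\<close> lies behind the other, which forces
  \<open>p = q\<close>.\<close>

lemma gate_mem_Int:
  assumes A: "delta_closed \<delta> M d A" and A': "delta_closed \<delta> M d A'"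
    and c: "c \<in> A" "c \<in> A'" and b: "b \<in> A"
  shows "gate d A' b \<in> A"
proof -
  have sub: "A \<subseteq> M" "A' \<subseteq> M" using A A' by (auto simp: delta_closed_def gated_def)
  define p where "p = gate d A' b"
  define q where "q = gate d A p"
  define r where "r = gate d A' q"
  have bM: "b \<in> M" and cM: "c \<in> M" using b c sub by auto
  have p: "p \<in> A'" "p \<in> M" unfolding p_def using gate_in[OF A' bM] .
  have q: "q \<in> A" "q \<in> M" unfolding q_def using gate_in[OF A p(2)] .
  have r: "r \<in> A'" "r \<in> M" unfolding r_def using gate_in[OF A' q(2)] .
  have 1: "d p b = d p q + d q b" unfolding q_def by (rule dist_gate[OF A p(2) b])
  have 2: "d b r = d b p + d p r" unfolding p_def by (rule dist_gate[OF A' bM r(1)])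
  have 3: "d q p = d q r + d r p" unfolding r_def by (rule dist_gate[OF A' q(2) p(1)])
  have "d b r \<le> d b q + d q r" by (rule triangle[OF bM q(2) r(2)])
  \<comment> \<open>Substituting 1 and 3 into the triangle inequality and comparing with 2 leaves
    \<open>2 * d p r \<le> 0\<close>.\<close>
  then have "d p r \<le> 0" using 1 2 3 nonneg[of p q] by (simp add: commute)
  then have "p = r" using nonneg[of p r] zero[OF p(2) r(2)] by linarith
  then have "d q c = d q p + d p c" unfolding r_def
    using dist_gate[OF A' q(2) c(2)] by simp
  moreover have "d p c = d p q + d q c" unfolding q_def by (rule dist_gate[OF A p(2) c(1)])
  ultimately have "d p q = 0" using nonneg[of p q] by (simp add: commute)
  then have "p = q" using zero[OF p(2) q(2)] by simp
  with q(1) show ?thesis unfolding p_def by simp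
qed

text \<open>By \<open>gate_mem_Int\<close> the gate map of \<open>A'\<close> sends \<open>A\<close>
  into the intersection and serves as a gate map there. So the intersection is closed in
  \<open>A\<close>, and transitivity finishes.\<close>

lemma delta_closed_Int:
  assumes A: "delta_closed \<delta> M d A" and A': "delta_closed \<delta> M d A'" and ne: "A \<inter> A' \<noteq> {}"
  shows "delta_closed \<delta> M d (A \<inter> A')"
proof -
  have sub: "A \<subseteq> M" "A' \<subseteq> M" using A A' by (auto simp: delta_closed_def gated_def)
  interpret A: Metric_space A d by (rule subspace[OF sub(1)])
  obtain c where c: "c \<in> A" "c \<in> A'" using ne by blast
  have g: "gate d A' b \<in> A \<inter> A'" if "b \<in> A" for b
    using gate_mem_Int[OF A A' c that] gate_in[OF A'] that sub by auto
  have "delta_closed \<delta> A d (A \<inter> A')"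
  proof (rule A.delta_closedI[where g = "gate d A'"])
    show "is_gate d (A \<inter> A') b (gate d A' b)" if "b \<in> A" for b
      using g[OF that] dist_gate[OF A', of b] that sub unfolding is_gate_def by blast
  qed (use ne dist_far_gates[OF A'] sub in auto)
  then show ?thesis by (rule delta_closed_trans[OF A])
qed

text \<open>Two points of different pieces have a point of \<open>A\<close> between them, and their
  gates lie on the way to it since \<open>A\<close> is contained in both \<open>D\<close> and
  \<open>D'\<close>. Hence the gates taken inside the pieces remain gates for the union.\<close>

lemma delta_closed_Un:
  assumes M: "M = F \<union> F'" and D: "delta_closed \<delta> F d D" and D': "delta_closed \<delta> F' d D'"
    and AD: "A \<subseteq> D" "A \<subseteq> D'"
    and bet: "\<And>b c. b \<in> F \<Longrightarrow> c \<in> F' \<Longrightarrow> \<exists>a\<in>A. d b c = d b a + d a c"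
  shows "delta_closed \<delta> M d (D \<union> D')"
proof -
  interpret F: Metric_space F d by (rule subspace) (use M in auto)
  interpret F': Metric_space F' d by (rule subspace) (use M in auto)
  have sub: "D \<subseteq> F" "D' \<subseteq> F'" "D \<noteq> {}" using D D' by (auto simp: delta_closed_def gated_def)
  \<comment> \<open>The hypothesis \<open>bet\<close> with \<open>b = c\<close> shows that the
    pieces meet only inside \<open>A\<close>, where both prescriptions are the identity, so
    preferring \<open>F\<close> is harmless.\<close>
  define g where "g b = (if b \<in> F then gate d D b else gate d D' b)" for b
  have gF: "g b \<in> D" "g b \<in> F" "g b \<in> M" if "b \<in> F" for b
    using F.gate_in[OF D that] that M by (auto simp: g_def)
  have gF': "g b \<in> D'" "g b \<in> F'" "g b \<in> M" if "b \<in> F'" "b \<notin> F" for b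
    using F'.gate_in[OF D' that(1)] that M by (auto simp: g_def)
  have dF: "d b a = d b (g b) + d (g b) a" if "b \<in> F" "a \<in> D" for a b
    using F.dist_gate[OF D that] that by (simp add: g_def)
  have dF': "d b a = d b (g b) + d (g b) a" if "b \<in> F'" "b \<notin> F" "a \<in> D'" for a b
    using F'.dist_gate[OF D' that(1,3)] that by (simp add: g_def)
  show ?thesis
  proof (rule delta_closedI[where g = g])
    show "D \<union> D' \<subseteq> M" "D \<union> D' \<noteq> {}" using sub M by auto
    show "is_gate d (D \<union> D') b (g b)" if b: "b \<in> M" for b
    proof (cases "b \<in> F")
      case True
      have "d b x = d b (g b) + d (g b) x" if x: "x \<in> D'" for x
      proof -
        obtain a where a: "a \<in> A" "d b x = d b a + d a x" using bet[OF True, of x] x sub by auto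
        have mem: "a \<in> M" "x \<in> M" "g b \<in> M" using a x AD sub M gF[OF True] by auto
        show ?thesis
          using a(2) dF[OF True, of a] a(1) AD triangle[OF mem(3,1,2)] triangle[OF b mem(3,2)] by auto
      qed
      then show ?thesis using gF[OF True] dF[OF True] unfolding is_gate_def by blast
    next
      case False
      then have b': "b \<in> F'" using b M by auto
      have "d b x = d b (g b) + d (g b) x" if x: "x \<in> D" for x
      proof -
        obtain a where a: "a \<in> A" "d x b = d x a + d a b" using bet[OF _ b', of x] x sub by auto
        have mem: "a \<in> M" "x \<in> M" "g b \<in> M" using a x AD sub M gF'[OF b' False] by auto
        show ?thesis
          using a(2) dF'[OF b' False, of a] a(1) AD triangle[OF mem(3,1,2)] triangle[OF b mem(3,2)]
          by (auto simp: commute)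
      qed
      then show ?thesis using gF'[OF b' False] dF'[OF b' False] unfolding is_gate_def by blast
    qed
    \<comment> \<open>Across the pieces the route through the gates is exact even when the gates are
      close, because it passes a point of \<open>A\<close>.\<close>
    have mixed: "d b b' = d b (g b) + d (g b) (g b') + d (g b') b'"
      if b: "b \<in> F" "b' \<in> F'" "b' \<notin> F" for b b'
    proof -
      obtain a where a: "a \<in> A" "d b b' = d b a + d a b'" using bet[OF b(1,2)] by auto
      have mem: "a \<in> M" "b \<in> M" "b' \<in> M" "g b \<in> M" "g b' \<in> M"
        using a b AD sub M gF[OF b(1)] gF'[OF b(2,3)] by auto
      have "d b a = d b (g b) + d (g b) a" "d b' a = d b' (g b') + d (g b') a"
        using dF[OF b(1)] dF'[OF b(2,3)] a(1) AD by auto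
      with a(2) triangle[OF mem(4,1,5)] triangle[OF mem(2,4,3)] triangle[OF mem(4,5,3)]
        commute[of b' a] commute[of b' "g b'"] commute[of "g b'" a]
      show ?thesis by linarith
    qed
    fix b b' assume b: "b \<in> M" "b' \<in> M" and far: "\<delta> < d (g b) (g b')"
    consider "b \<in> F" "b' \<in> F" | "b \<in> F" "b' \<in> F'" "b' \<notin> F" | "b' \<in> F" "b \<in> F'" "b \<notin> F"
      | "b \<in> F'" "b \<notin> F" "b' \<in> F'" "b' \<notin> F" using b M by auto
    then show "d b b' = d b (g b) + d (g b) (g b') + d (g b') b'"
    proof cases
      case 1 then show ?thesis using F.dist_far_gates[OF D 1] far by (simp add: g_def)
    next
      case 2 then show ?thesis by (rule mixed)
    next
      case 3 then show ?thesis using mixed[OF 3] by (simp add: commute)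
    next
      case 4 then show ?thesis using F'.dist_far_gates[OF D' 4(1,3)] far by (simp add: g_def)
    qed
  qed
qed

section \<open>Transport of closed sets along isometries\<close>

lemma isometric_on_inj:
  assumes "isometric_on M d e f" "Metric_space (f ` M) e"
  shows "inj_on f M"
proof (rule inj_onI)
  interpret I: Metric_space "f ` M" e by (rule assms(2))
  fix x y assume xy: "x \<in> M" "y \<in> M" "f x = f y"
  then have "e (f x) (f y) = 0" using I.zero[of "f x" "f y"] by blast
  then have "d x y = 0" using assms(1) xy unfolding isometric_on_def by metis
  with zero[OF xy(1,2)] show "x = y" by simp
qed

text \<open>The gate map is conjugated by \<open>f\<close>. Closedness is claimed only within the
  image of \<open>M\<close>; when that image is closed in a larger space,
  \<open>delta_closed_trans\<close> carries it further.\<close>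

lemma delta_closed_image:
  assumes f: "isometric_on M d e f" "Metric_space (f ` M) e" and A: "delta_closed \<delta> M d A"
  shows "delta_closed \<delta> (f ` M) e (f ` A)"
proof -
  interpret I: Metric_space "f ` M" e by (rule f(2))
  have inj: "inj_on f M" by (rule isometric_on_inj[OF f])
  have sub: "A \<subseteq> M" "A \<noteq> {}" using A by (auto simp: delta_closed_def gated_def)
  have e: "e (f x) (f y) = d x y" if "x \<in> M" "y \<in> M" for x y
    using f(1) that by (simp add: isometric_on_def)
  have inv: "inv_into M f (f x) = x" if "x \<in> M" for x using inj that by simp
  show ?thesis
  proof (rule I.delta_closedI[where g = "\<lambda>y. f (gate d A (inv_into M f y))"])
    fix y assume "y \<in> f ` M"
    then obtain b where b: "b \<in> M" "y = f b" by auto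
    have "e (f b) (f a) = e (f b) (f (gate d A b)) + e (f (gate d A b)) (f a)" if "a \<in> A" for a
      unfolding e[OF b(1) subsetD[OF sub(1) that]] e[OF b(1) gate_in(2)[OF A b(1)]]
        e[OF gate_in(2)[OF A b(1)] subsetD[OF sub(1) that]]
      by (rule dist_gate[OF A b(1) that])
    then show "is_gate e (f ` A) y (f (gate d A (inv_into M f y)))"
      unfolding is_gate_def b(2) inv[OF b(1)] using gate_in[OF A b(1)] by blast
  next
    fix y y' assume "y \<in> f ` M" "y' \<in> f ` M"
      and far: "\<delta> < e (f (gate d A (inv_into M f y))) (f (gate d A (inv_into M f y')))"
    then obtain b b' where b: "b \<in> M" "y = f b" "b' \<in> M" "y' = f b'" by auto
    have "\<delta> < d (gate d A b) (gate d A b')"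
      using far b e gate_in[OF A b(1)] gate_in[OF A b(3)] by (simp add: inv)
    from dist_far_gates[OF A b(1,3) this] b e gate_in[OF A b(1)] gate_in[OF A b(3)]
    show "e y y' = e y (f (gate d A (inv_into M f y))) +
        e (f (gate d A (inv_into M f y))) (f (gate d A (inv_into M f y'))) +
        e (f (gate d A (inv_into M f y'))) y'"
      by (simp add: inv)
  qed (use sub in auto)
qed

end

section \<open>Free amalgams\<close>

text \<open>Length of the route from \<open>x\<close> to \<open>y\<close> by way of both gates. It
  serves as the distance from \<open>x\<close> to the copy of \<open>y\<close> on the other side of
  the amalgam.\<close>

definition through_gates :: "('a \<Rightarrow> 'a \<Rightarrow> real) \<Rightarrow> 'a set \<Rightarrow> 'a \<Rightarrow> 'a \<Rightarrow> real" where
  "through_gates d A x y = d x (gate d A x) + d (gate d A x) (gate d A y) + d (gate d A y) y"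

fun amalgam_dist ::
  "('a \<Rightarrow> 'a \<Rightarrow> real) \<Rightarrow> 'a set \<Rightarrow> 'a \<times> bool \<Rightarrow> 'a \<times> bool \<Rightarrow> real" where
  "amalgam_dist d A (x, s) (y, t) = (if s = t then d x y else through_gates d A x y)"

text \<open>Points of \<open>A\<close> occur with tag \<open>True\<close> only, which glues the
  copies along \<open>A\<close>. The left copy consists of the pairs \<open>(x, True)\<close>, the
  right copy of the pairs \<open>(x, x \<in> A)\<close>.\<close>

definition amalgam :: "'a set \<Rightarrow> 'a set \<Rightarrow> ('a \<times> bool) set" where
  "amalgam M A = M \<times> {True} \<union> (M - A) \<times> {False}"

context Metric_space
begin

lemma through_gates_commute: "through_gates d A x y = through_gates d A y x"
  by (simp add: through_gates_def commute)

context
  fixes \<delta> A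
  assumes A: "delta_closed \<delta> M d A"
begin

text \<open>The gate of \<open>x\<close> lies between \<open>x\<close> and the gate of
  \<open>y\<close>, so the first two legs merge into one distance.\<close>

lemma through_gates_eq:
  assumes "x \<in> M" "y \<in> M"
  shows "through_gates d A x y = d x (gate d A y) + d (gate d A y) y"
  using dist_gate[OF A assms(1) gate_in(1)[OF A assms(2)]] by (simp add: through_gates_def)

lemma dist_le_through_gates:
  assumes "x \<in> M" "y \<in> M"
  shows "d x y \<le> through_gates d A x y"
  using through_gates_eq[OF assms] triangle[OF assms(1) gate_in(2)[OF A assms(2)] assms(2)] by simp

lemma through_gates_triangle:
  assumes "x \<in> M" "y \<in> M" "z \<in> M"
  shows "through_gates d A x z \<le> d x y + through_gates d A y z"
  using triangle[OF assms(1,2) gate_in(2)[OF A assms(3)]]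
  by (simp add: through_gates_eq assms)

lemma dist_le_through_gates_add:
  assumes "x \<in> M" "y \<in> M" "z \<in> M"
  shows "d x z \<le> through_gates d A x y + through_gates d A y z"
  using dist_le_through_gates[OF assms(1,3)] nonneg[of y "gate d A y"] nonneg[of "gate d A y" y]
    triangle[OF gate_in(2)[OF A assms(1)] gate_in(2)[OF A assms(2)] gate_in(2)[OF A assms(3)]]
  unfolding through_gates_def by linarith

text \<open>Makes the tag of a point of \<open>A\<close> irrelevant to distances, so that the right
  copy is isometric to \<open>M\<close> although its points of \<open>A\<close> carry the tag
  \<open>True\<close>.\<close>

lemma through_gates_self:
  assumes "x \<in> A" "y \<in> M"
  shows "through_gates d A x y = d x y"
proof -
  have "A \<subseteq> M" using A by (simp add: delta_closed_def gated_def)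
  then show ?thesis
    using dist_gate[OF A assms(2,1)] gate_self[OF assms(1)] assms
    by (auto simp: through_gates_def commute)
qed

text \<open>Distance zero across the tags would give a single point equal to its own gate, hence in
  \<open>A\<close>, where only one tag occurs. The triangle inequality splits according to which of
  the three points, if any, is alone on its side.\<close>

lemma Metric_space_amalgam: "Metric_space (amalgam M A) (amalgam_dist d A)"
proof
  fix p q :: "'a \<times> bool"
  obtain x s where p: "p = (x, s)" by fastforce
  obtain y t where q: "q = (y, t)" by fastforce
  show "0 \<le> amalgam_dist d A p q" by (simp add: p q through_gates_def)
  show "amalgam_dist d A p q = amalgam_dist d A q p"
    using through_gates_commute[of A x y] by (simp add: p q commute)
  assume mem: "p \<in> amalgam M A" "q \<in> amalgam M A"
  then have M: "x \<in> M" "y \<in> M" by (auto simp: amalgam_def p q)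
  show "amalgam_dist d A p q = 0 \<longleftrightarrow> p = q"
  proof (cases "s = t")
    case True
    then show ?thesis using M by (simp add: p q)
  next
    case False
    have "through_gates d A x y \<noteq> 0"
    proof
      assume 0: "through_gates d A x y = 0"
      have "d x y = 0" "d x (gate d A x) = 0"
        using 0 dist_le_through_gates[OF M] nonneg[of x y] nonneg[of x "gate d A x"]
          nonneg[of "gate d A x" "gate d A y"] nonneg[of "gate d A y" y]
        unfolding through_gates_def by linarith+
      then have "x = y" "x = gate d A x"
        using zero[OF M] zero[OF M(1) gate_in(2)[OF A M(1)]] by blast+
      then show False
        using False mem gate_in(1)[OF A M(1)] by (auto simp: amalgam_def p q)
    qed
    then show ?thesis using False by (simp add: p q)
  qed
next
  fix p q r :: "'a \<times> bool"
  obtain x s where p: "p = (x, s)" by fastforce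
  obtain y t where q: "q = (y, t)" by fastforce
  obtain z u where r: "r = (z, u)" by fastforce
  assume "p \<in> amalgam M A" "q \<in> amalgam M A" "r \<in> amalgam M A"
  then have M: "x \<in> M" "y \<in> M" "z \<in> M" by (auto simp: amalgam_def p q r)
  show "amalgam_dist d A p r \<le> amalgam_dist d A p q + amalgam_dist d A q r"
    using triangle[OF M] through_gates_triangle[OF M] dist_le_through_gates_add[OF M]
      through_gates_triangle[OF M(3,2,1)]
    by (auto simp: p q r through_gates_commute commute)
qed

text \<open>Four points, three of them on the same side: moving the fourth one to its gate changes all
  three sums by the same amount.\<close>

lemma hyperbolic_amalgam_31:
  assumes hyp: "hyperbolic \<delta> M d" and M: "x \<in> M" "y \<in> M" "z \<in> M" "w \<in> M"
  shows "d x y + through_gates d A z w \<le>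
    max (d x z + through_gates d A y w) (d y z + through_gates d A x w) + 2 * \<delta>"
proof -
  have "gate d A w \<in> M" using gate_in[OF A M(4)] by simp
  then have "d x y + d z (gate d A w) \<le>
      max (d x z + d y (gate d A w)) (d y z + d x (gate d A w)) + 2 * \<delta>"
    using hyp[unfolded hyperbolic_def, rule_format, of x z "gate d A w" y] M
    by (simp add: commute)
  then show ?thesis using M by (simp add: through_gates_eq)
qed

text \<open>Here \<open>x\<close>, \<open>y\<close> lie on one side and \<open>z\<close>,
  \<open>w\<close> on the other. Both cross sums are the sums for the gates plus the same four legs.
  If both pairs of gates are far apart, \<open>S1\<close> has this form too and the inequalities for
  the gates transfer. Otherwise two gates on one side are within \<delta>, so exchanging them
  changes each cross distance by at most \<delta>, and \<open>S2\<close>, \<open>S3\<close> differ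
  by at most \<open>2 * \<delta>\<close>.\<close>

lemma hyperbolic_amalgam_22:
  assumes hyp: "hyperbolic \<delta> M d" and M: "x \<in> M" "y \<in> M" "z \<in> M" "w \<in> M"
  defines "S1 \<equiv> d x y + d z w"
    and "S2 \<equiv> through_gates d A x z + through_gates d A y w"
    and "S3 \<equiv> through_gates d A x w + through_gates d A y z"
  shows "S1 \<le> max S2 S3 + 2 * \<delta>" "S2 \<le> max S1 S3 + 2 * \<delta>" "S3 \<le> max S1 S2 + 2 * \<delta>"
proof -
  let ?g = "gate d A"
  have g: "?g x \<in> M" "?g y \<in> M" "?g z \<in> M" "?g w \<in> M"
    using gate_in(2)[OF A] M by auto
  note S = S1_def S2_def S3_def through_gates_def
  have hyp': "d a b + d c e \<le> max (d a c + d b e) (d a e + d b c) + 2 * \<delta>"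
    if "a \<in> M" "b \<in> M" "c \<in> M" "e \<in> M" for a b c e
    using hyp[unfolded hyperbolic_def, rule_format, of a c e b] that
    by (simp add: commute)
  have 1: "d (?g x) (?g y) + d (?g z) (?g w) \<le>
      max (d (?g x) (?g z) + d (?g y) (?g w)) (d (?g x) (?g w) + d (?g y) (?g z)) + 2 * \<delta>"
    using hyp'[OF g(1,2,3,4)] .
  have 2: "d (?g x) (?g z) + d (?g y) (?g w) \<le>
      max (d (?g x) (?g y) + d (?g z) (?g w)) (d (?g x) (?g w) + d (?g y) (?g z)) + 2 * \<delta>"
    using hyp'[OF g(1,3,2,4)] by (simp add: commute)
  have 3: "d (?g x) (?g w) + d (?g y) (?g z) \<le>
      max (d (?g x) (?g y) + d (?g z) (?g w)) (d (?g x) (?g z) + d (?g y) (?g w)) + 2 * \<delta>"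
    using hyp'[OF g(1,4,2,3)] by (simp add: commute)
  have le: "d x y \<le> through_gates d A x y" "d z w \<le> through_gates d A z w"
    using dist_le_through_gates M by auto
  show "S1 \<le> max S2 S3 + 2 * \<delta>" using 1 le by (simp add: S commute)
  have "S2 \<le> max S1 S3 + 2 * \<delta> \<and> S3 \<le> max S1 S2 + 2 * \<delta>"
  proof (cases "\<delta> < d (?g x) (?g y) \<and> \<delta> < d (?g z) (?g w)")
    case True
    then have "d x y = through_gates d A x y" "d z w = through_gates d A z w"
      using dist_far_gates[OF A] M by (auto simp: through_gates_def)
    then show ?thesis using 2 3 unfolding S
      by (simp only: commute) linarith
  next
    case False
    then have "d (?g x) (?g y) \<le> \<delta> \<or> d (?g z) (?g w) \<le> \<delta>" by auto
    then have "S2 \<le> S3 + 2 * \<delta> \<and> S3 \<le> S2 + 2 * \<delta>"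
    proof
      assume "d (?g x) (?g y) \<le> \<delta>"
      then show ?thesis
        using triangle[OF g(1,2,3)] triangle[OF g(1,2,4)] triangle[OF g(2,1,3)] triangle[OF g(2,1,4)]
        by (simp add: S commute)
    next
      assume "d (?g z) (?g w) \<le> \<delta>"
      then show ?thesis
        using triangle[OF g(1,3,4)] triangle[OF g(2,3,4)] triangle[OF g(1,4,3)] triangle[OF g(2,4,3)]
        by (simp add: S commute)
    qed
    then show ?thesis by linarith
  qed
  then show "S2 \<le> max S1 S3 + 2 * \<delta>" "S3 \<le> max S1 S2 + 2 * \<delta>" by auto
qed

lemma hyperbolic_amalgam:
  assumes hyp: "hyperbolic \<delta> M d"
  shows "hyperbolic \<delta> (amalgam M A) (amalgam_dist d A)"
  unfolding hyperbolic_def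
proof (intro ballI)
  fix p1 p2 p3 p4 assume p: "p1 \<in> amalgam M A" "p2 \<in> amalgam M A" "p3 \<in> amalgam M A" "p4 \<in> amalgam M A"
  obtain x1 s1 x2 s2 x3 s3 x4 s4
    where xs: "p1 = (x1, s1)" "p2 = (x2, s2)" "p3 = (x3, s3)" "p4 = (x4, s4)" by fastforce
  have M: "x1 \<in> M" "x2 \<in> M" "x3 \<in> M" "x4 \<in> M" using p by (auto simp: amalgam_def xs)
  \<comment> \<open>Only equality of tags matters, so the sixteen tag patterns reduce to eight: all
    four points together in \<open>h0\<close>; one of \<open>x1\<close> to \<open>x4\<close> alone
    in \<open>h1\<close> to \<open>h4\<close>; and \<open>x1\<close> paired with \<open>x4\<close>,
    \<open>x2\<close>, \<open>x3\<close> in \<open>h5\<close>, \<open>h6\<close>,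
    \<open>h7\<close>.\<close>
  have h0: "d x1 x4 + d x2 x3 \<le> max (d x1 x2 + d x3 x4) (d x1 x3 + d x2 x4) + 2 * \<delta>"
    using hyp M by (simp add: hyperbolic_def)
  have h1: "through_gates d A x1 x4 + d x2 x3 \<le> max (through_gates d A x1 x2 + d x3 x4) (through_gates d A x1 x3 + d x2 x4) + 2 * \<delta>"
    using hyperbolic_amalgam_31[OF hyp M(2,3,4,1)] by (simp add: through_gates_commute[of A] commute add.commute max.commute)
  have h2: "d x1 x4 + through_gates d A x2 x3 \<le> max (through_gates d A x1 x2 + d x3 x4) (d x1 x3 + through_gates d A x2 x4) + 2 * \<delta>"
    using hyperbolic_amalgam_31[OF hyp M(1,4,3,2)] by (simp add: through_gates_commute[of A] commute add.commute max.commute)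
  have h3: "d x1 x4 + through_gates d A x2 x3 \<le> max (d x1 x2 + through_gates d A x3 x4) (through_gates d A x1 x3 + d x2 x4) + 2 * \<delta>"
    using hyperbolic_amalgam_31[OF hyp M(1,4,2,3)] by (simp add: through_gates_commute[of A] commute add.commute max.commute)
  have h4: "through_gates d A x1 x4 + d x2 x3 \<le> max (d x1 x2 + through_gates d A x3 x4) (d x1 x3 + through_gates d A x2 x4) + 2 * \<delta>"
    using hyperbolic_amalgam_31[OF hyp M(2,3,1,4)] by (simp add: through_gates_commute[of A] commute add.commute max.commute)
  have h5: "d x1 x4 + d x2 x3 \<le> max (through_gates d A x1 x2 + through_gates d A x3 x4) (through_gates d A x1 x3 + through_gates d A x2 x4) + 2 * \<delta>"
    using hyperbolic_amalgam_22(1)[OF hyp M(1,4,2,3)] by (simp add: through_gates_commute[of A] commute add.commute max.commute)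
  have h6: "through_gates d A x1 x4 + through_gates d A x2 x3 \<le> max (d x1 x2 + d x3 x4) (through_gates d A x1 x3 + through_gates d A x2 x4) + 2 * \<delta>"
    using hyperbolic_amalgam_22(3)[OF hyp M(1,2,3,4)] by (simp add: through_gates_commute[of A] commute add.commute max.commute)
  have h7: "through_gates d A x1 x4 + through_gates d A x2 x3 \<le> max (through_gates d A x1 x2 + through_gates d A x3 x4) (d x1 x3 + d x2 x4) + 2 * \<delta>"
    using hyperbolic_amalgam_22(3)[OF hyp M(1,3,2,4)] by (simp add: through_gates_commute[of A] commute add.commute max.commute)
  show "amalgam_dist d A p1 p4 + amalgam_dist d A p2 p3 \<le>
      max (amalgam_dist d A p1 p2 + amalgam_dist d A p3 p4)
        (amalgam_dist d A p1 p3 + amalgam_dist d A p2 p4) + 2 * \<delta>"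
    unfolding xs using h0 h1 h2 h3 h4 h5 h6 h7
    by (cases s1; cases s2; cases s3; cases s4; simp only: amalgam_dist.simps simp_thms if_True if_False)
qed

section \<open>The two copies inside the amalgam\<close>

lemma rational_distances_amalgam:
  assumes "rational_distances M d"
  shows "rational_distances (amalgam M A) (amalgam_dist d A)"
  using assms gate_in(2)[OF A]
  by (auto simp: rational_distances_def amalgam_def through_gates_def)

lemma amalgam_eq: "amalgam M A = (\<lambda>x. (x, True)) ` M \<union> (\<lambda>x. (x, x \<in> A)) ` M"
  using A by (auto simp: amalgam_def delta_closed_def gated_def image_iff)

lemma isometric_on_amalgam_left: "isometric_on M d (amalgam_dist d A) (\<lambda>x. (x, True))"
  by (simp add: isometric_on_def)

lemma isometric_on_amalgam_right: "isometric_on M d (amalgam_dist d A) (\<lambda>x. (x, x \<in> A))"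
  unfolding isometric_on_def amalgam_dist.simps
  using through_gates_self through_gates_commute[of A] commute by metis

text \<open>The gate of \<open>c\<close> is the witness, as every distance across passes it. This
  supplies the hypothesis \<open>bet\<close> of \<open>delta_closed_Un\<close>.\<close>

lemma amalgam_between:
  assumes "b \<in> M" "c \<in> M"
  shows "\<exists>a\<in>A. amalgam_dist d A (b, True) (c, c \<in> A) =
    amalgam_dist d A (b, True) (a, True) + amalgam_dist d A (a, True) (c, c \<in> A)"
proof (rule bexI[OF _ gate_in(1)[OF A assms(2)]])
  have AM: "A \<subseteq> M" using A by (simp add: delta_closed_def gated_def)
  have g: "gate d A c \<in> A" "gate d A c \<in> M" using gate_in[OF A assms(2)] by auto
  show "amalgam_dist d A (b, True) (c, c \<in> A) =
    amalgam_dist d A (b, True) (gate d A c, True) + amalgam_dist d A (gate d A c, True) (c, c \<in> A)"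
    using gate_self[OF _ AM, of c] through_gates_eq[OF assms] through_gates_eq[OF g(2) assms(2)]
      assms g by simp
qed

text \<open>Each copy is the union of itself with the copy of \<open>A\<close> on the other side, so
  \<open>delta_closed_Un\<close> applies with a whole piece and \<open>A\<close>.\<close>

lemma delta_closed_amalgam_left:
  "delta_closed \<delta> (amalgam M A) (amalgam_dist d A) ((\<lambda>x. (x, True)) ` M)" (is ?L)
  and delta_closed_amalgam_right:
  "delta_closed \<delta> (amalgam M A) (amalgam_dist d A) ((\<lambda>x. (x, x \<in> A)) ` M)" (is ?R)
proof -
  let ?e = "amalgam_dist d A" and ?l = "\<lambda>x. (x, True)" and ?r = "\<lambda>x. (x, x \<in> A)"
  interpret E: Metric_space "amalgam M A" ?e by (rule Metric_space_amalgam)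
  have AM: "A \<subseteq> M" "M \<noteq> {}" using A by (auto simp: delta_closed_def gated_def)
  have lr: "?l ` A = ?r ` A" by auto
  have l: "Metric_space (?l ` M) ?e" and r: "Metric_space (?r ` M) ?e"
    by (rule E.subspace; simp add: amalgam_eq)+
  note li = delta_closed_image[OF isometric_on_amalgam_left l]
    and ri = delta_closed_image[OF isometric_on_amalgam_right r]
  have bet: "\<exists>a\<in>?l ` A. ?e b c = ?e b a + ?e a c" if "b \<in> ?l ` M" "c \<in> ?r ` M" for b c
    using that amalgam_between by auto
  have "delta_closed \<delta> (amalgam M A) ?e (?l ` M \<union> ?r ` A)"
    by (rule E.delta_closed_Un[OF amalgam_eq li[OF delta_closed_whole[OF AM(2)]] ri[OF A] _ _ bet])
      (use AM in auto)
  moreover have "?l ` M \<union> ?r ` A = ?l ` M" using AM lr by blast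
  ultimately show ?L by simp
  have "delta_closed \<delta> (amalgam M A) ?e (?l ` A \<union> ?r ` M)"
    by (rule E.delta_closed_Un[OF amalgam_eq li[OF A] ri[OF delta_closed_whole[OF AM(2)]] _ _ bet])
      (use AM in auto)
  moreover have "?l ` A \<union> ?r ` M = ?r ` M" using AM lr by blast
  ultimately show ?R by simp
qed

end

end

section \<open>The isometry group\<close>

context
  fixes H :: "'a set" and d :: "'a \<Rightarrow> 'a \<Rightarrow> real" and g
  assumes g: "g \<in> carrier (isom_group H d)"
begin

lemma isom_image: "g ` H = H"
  using g by (simp add: carrier_isom_group Bij_def bij_betw_def)

lemma isom_in: "x \<in> H \<Longrightarrow> g x \<in> H"
  using isom_image by blast

lemma isom_dist: "x \<in> H \<Longrightarrow> y \<in> H \<Longrightarrow> d (g x) (g y) = d x y"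
  using g by (simp add: carrier_isom_group isometric_on_def)

lemma isom_eq_iff: "x \<in> H \<Longrightarrow> y \<in> H \<Longrightarrow> g x = g y \<longleftrightarrow> x = y"
  using g by (auto simp: carrier_isom_group Bij_def bij_betw_def inj_on_eq_iff)

lemma isom_inv_closed: "inv\<^bsub>isom_group H d\<^esub> g \<in> carrier (isom_group H d)"
  using group.inv_closed[OF group_isom_group g] .

lemma isom_inv_left: "x \<in> H \<Longrightarrow> (inv\<^bsub>isom_group H d\<^esub> g) (g x) = x"
  using mult_isom_group[OF isom_inv_closed g, of x] group.l_inv[OF group_isom_group g]
  by (simp add: isom_group_def BijGroup_def)

lemma isom_inv_right: "x \<in> H \<Longrightarrow> g ((inv\<^bsub>isom_group H d\<^esub> g) x) = x"
  using mult_isom_group[OF g isom_inv_closed, of x] group.r_inv[OF group_isom_group g]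
  by (simp add: isom_group_def BijGroup_def)

lemma delta_closed_isom_image:
  assumes "Metric_space H d" "delta_closed \<delta> H d A"
  shows "delta_closed \<delta> H d (g ` A)"
  using Metric_space.delta_closed_image[OF assms(1), of d g \<delta> A] assms g isom_image
  by (simp add: carrier_isom_group)

end

lemma pointwise_stabilizerD:
  assumes "g \<in> pointwise_stabilizer H d A"
  shows "g \<in> carrier (isom_group H d)" "a \<in> A \<Longrightarrow> g a = a"
  using assms by (auto simp: pointwise_stabilizer_def)

section \<open>The space\<close>

locale H_delta =
  fixes \<delta> :: real and H :: "'a set" and d :: "'a \<Rightarrow> 'a \<Rightarrow> real"
  assumes nonneg_delta: "\<delta> \<ge> 0" and is_H: "is_H_delta \<delta> H d"
begin

sublocale Metric_space H d
  using is_H by (simp add: is_H_delta_def)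

abbreviation G where "G \<equiv> isom_group H d"

abbreviation stab where "stab \<equiv> pointwise_stabilizer H d"

section \<open>Exhaustion, universality, homogeneity and closures\<close>

lemma delta_closed_subsetD: "delta_closed \<delta> H d A \<Longrightarrow> A \<subseteq> H"
  by (simp add: delta_closed_def gated_def)

lemma exhaustion:
  obtains C :: "nat \<Rightarrow> 'a set"
  where "incseq C" "\<And>n. finite (C n)" "\<And>n. delta_closed \<delta> H d (C n)" "(\<Union>n. C n) = H"
proof -
  have "\<exists>C :: nat \<Rightarrow> 'a set. incseq C \<and> (\<forall>n. finite (C n) \<and> delta_closed \<delta> H d (C n)) \<and> (\<Union>n. C n) = H"
    using is_H by (simp only: is_H_delta_def)
  then show ?thesis using that by blast
qed

lemma finite_subset_exhaustion:
  assumes "incseq C" "(\<Union>n::nat. C n) = H" "finite S" "S \<subseteq> H"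
  shows "\<exists>n. S \<subseteq> C n"
  using assms(3,4)
proof (induction S)
  case (insert x S)
  then obtain n m where "S \<subseteq> C n" "x \<in> C m" using assms(2) by auto
  then have "insert x S \<subseteq> C (max n m)"
    using incseqD[OF assms(1), of n "max n m"] incseqD[OF assms(1), of m "max n m"] by auto
  then show ?case by blast
qed simp

lemma finite_closed_superset:
  assumes "finite S" "S \<subseteq> H"
  obtains D where "finite D" "delta_closed \<delta> H d D" "S \<subseteq> D"
  using exhaustion finite_subset_exhaustion[OF _ _ assms] by metis

text \<open>Universality is available for metrics on sets of natural numbers; an enumeration
  \<open>h\<close> of \<open>N\<close> transports \<open>e\<close> there.\<close>

lemma embedding:
  assumes "Metric_space N e" "finite N" "N \<noteq> {}" "hyperbolic \<delta> N e" "rational_distances N e"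
  obtains f where "f ` N \<subseteq> H" "isometric_on N e d f" "delta_closed \<delta> H d (f ` N)"
proof -
  interpret N: Metric_space N e by (rule assms(1))
  obtain h :: "_ \<Rightarrow> nat" where h: "bij_betw h N {0..<card N}"
    using ex_bij_betw_finite_nat[OF assms(2)] by blast
  define i where "i = inv_into N h"
  have bi: "bij_betw i {0..<card N} N" unfolding i_def by (rule bij_betw_inv_into[OF h])
  have im: "i ` {0..<card N} = N" using bi by (simp add: bij_betw_def)
  have iN: "i x \<in> N" if "x < card N" for x using im that by auto
  have eq: "i x = i y \<longleftrightarrow> x = y" if "x < card N" "y < card N" for x y
    using bi that by (auto simp: bij_betw_def inj_on_def)
  have ih: "i (h x) = x" "h x < card N" if "x \<in> N" for x
    using h that by (auto simp: i_def bij_betw_def inv_into_f_f)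
  let ?e = "\<lambda>x y. e (i x) (i y)"
  have "Metric_space {0..<card N} ?e"
    by unfold_locales (auto simp: N.nonneg N.commute iN eq N.triangle)
  moreover have "hyperbolic \<delta> {0..<card N} ?e" "rational_distances {0..<card N} ?e"
    using assms(4,5) by (auto simp: hyperbolic_def rational_distances_def iN)
  moreover have "{0..<card N} \<noteq> {}" using assms(2,3) by auto
  ultimately obtain f where f: "f ` {0..<card N} \<subseteq> H" "isometric_on {0..<card N} ?e d f"
      "delta_closed \<delta> H d (f ` {0..<card N})"
    using is_H unfolding is_H_delta_def by (metis finite_atLeastLessThan)
  have "(f \<circ> h) ` N = f ` {0..<card N}" using h by (metis bij_betw_def image_comp)
  then show ?thesis
    using that[of "f \<circ> h"] f ih by (simp add: isometric_on_def)
qed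

lemma extension:
  assumes "finite D" "delta_closed \<delta> H d D" "isometric_on D d d f" "delta_closed \<delta> H d (f ` D)"
  shows "\<exists>g\<in>carrier G. \<forall>x\<in>D. g x = f x"
proof -
  interpret D: Metric_space D d by (rule subspace[OF delta_closed_subsetD[OF assms(2)]])
  have "inj_on f D"
    by (rule D.isometric_on_inj[OF assms(3) subspace[OF delta_closed_subsetD[OF assms(4)]]])
  then have "bij_betw f D (f ` D)" by (rule inj_on_imp_bij_betw)
  then obtain g where g: "bij_betw g H H" "isometric_on H d d g" "\<forall>a\<in>D. g a = f a"
    using is_H assms unfolding is_H_delta_def by (metis finite_imageI)
  \<comment> \<open>Elements of \<open>Bij\<close> are extensional, so values outside
    \<open>H\<close> must be reset.\<close>
  have "restrict g H \<in> carrier G"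
    using g by (auto simp: carrier_isom_group Bij_def isometric_on_def cong: bij_betw_cong)
  moreover have "restrict g H x = f x" if "x \<in> D" for x
    using g that delta_closed_subsetD[OF assms(2)] by auto
  ultimately show ?thesis by blast
qed

text \<open>A finite closed superset of least cardinality is contained in every closed superset:
  their intersection contains the nonempty \<open>B\<close>, so it is closed, and it cannot be
  smaller.\<close>

lemma delta_cl:
  assumes "finite B" "B \<noteq> {}" "B \<subseteq> H"
  shows "finite (delta_cl \<delta> H d B)" "delta_closed \<delta> H d (delta_cl \<delta> H d B)"
proof -
  let ?P = "\<lambda>A. finite A \<and> delta_closed \<delta> H d A \<and> B \<subseteq> A"
  obtain D where "?P D" using finite_closed_superset[OF assms(1,3)] by metis
  then obtain A where A: "?P A" and min: "\<And>A'. ?P A' \<Longrightarrow> card A \<le> card A'"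
    using ex_has_least_nat[of ?P D card] by blast
  have "A \<subseteq> A'" if A': "delta_closed \<delta> H d A'" "B \<subseteq> A'" for A'
  proof -
    have "?P (A \<inter> A')" using delta_closed_Int[of \<delta> A A'] A A' assms(2) by blast
    from min[OF this] A have "A \<inter> A' = A" by (metis card_seteq inf_le1)
    then show ?thesis by blast
  qed
  then have "delta_cl \<delta> H d B = A" using A by (auto simp: delta_cl_def)
  then show "finite (delta_cl \<delta> H d B)" "delta_closed \<delta> H d (delta_cl \<delta> H d B)" using A by auto
qed

section \<open>Amalgamation inside the space\<close>

text \<open>The amalgam of two copies of \<open>F\<close> over \<open>A\<close> embeds as a closed
  set. Both copies are closed there, so homogeneity realises them as images of \<open>F\<close>
  under \<alpha> and \<beta>, and \<open>k\<close> is \<beta> followed by the inverse of \<alpha>.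
  It fixes \<open>A\<close> because the copies coincide on \<open>A\<close>.\<close>

lemma independent_copy:
  assumes A: "delta_closed \<delta> H d A" and F: "finite F" "delta_closed \<delta> H d F" and "A \<subseteq> F"
  obtains k where "k \<in> stab A" "delta_closed \<delta> H d (F \<union> k ` F)"
    "\<And>b c. b \<in> F \<Longrightarrow> c \<in> F \<Longrightarrow> \<exists>a\<in>A. d b (k c) = d b a + d a (k c)"
proof -
  have FH: "F \<subseteq> H" "F \<noteq> {}" using F by (auto simp: delta_closed_def gated_def)
  interpret F: Metric_space F d by (rule subspace[OF FH(1)])
  have AF: "delta_closed \<delta> F d A" by (rule delta_closed_subset[OF A \<open>A \<subseteq> F\<close> FH(1)])
  let ?X = "amalgam F A" and ?e = "amalgam_dist d A"
  let ?l = "\<lambda>x. (x, True)" and ?r = "\<lambda>x. (x, x \<in> A)"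
  interpret X: Metric_space ?X ?e by (rule F.Metric_space_amalgam[OF AF])
  have hyp: "hyperbolic \<delta> F d" "rational_distances F d"
    using is_H FH(1) unfolding is_H_delta_def hyperbolic_def rational_distances_def
    by (meson subsetD)+
  have X: "finite ?X" "?X \<noteq> {}" using F(1) FH(2) by (auto simp: amalgam_def)
  obtain \<phi> where \<phi>: "\<phi> ` ?X \<subseteq> H" "isometric_on ?X ?e d \<phi>" "delta_closed \<delta> H d (\<phi> ` ?X)"
    using embedding[OF X.Metric_space_axioms X F.hyperbolic_amalgam[OF AF hyp(1)]
      F.rational_distances_amalgam[OF AF hyp(2)]] .
  have X_eq: "?X = ?l ` F \<union> ?r ` F" by (rule F.amalgam_eq[OF AF])
  have lX: "?l x \<in> ?X" and rX: "?r x \<in> ?X" if "x \<in> F" for x using that X_eq by auto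
  have \<phi>d: "d (\<phi> p) (\<phi> q) = ?e p q" if "p \<in> ?X" "q \<in> ?X" for p q
    using \<phi>(2) that by (simp add: isometric_on_def)
  have cl: "delta_closed \<delta> H d (\<phi> ` Y)" if "delta_closed \<delta> ?X ?e Y" for Y
    using delta_closed_trans[OF \<phi>(3) X.delta_closed_image[OF \<phi>(2) subspace[OF \<phi>(1)] that]] .
  have "isometric_on F d d (\<lambda>x. \<phi> (?l x))" "isometric_on F d d (\<lambda>x. \<phi> (?r x))"
    using F.isometric_on_amalgam_left[OF AF] F.isometric_on_amalgam_right[OF AF] \<phi>d lX rX
    by (simp_all add: isometric_on_def)
  moreover have "delta_closed \<delta> H d ((\<lambda>x. \<phi> (?l x)) ` F)" "delta_closed \<delta> H d ((\<lambda>x. \<phi> (?r x)) ` F)"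
    using cl[OF F.delta_closed_amalgam_left[OF AF]] cl[OF F.delta_closed_amalgam_right[OF AF]]
    by (simp_all add: image_image)
  ultimately have "\<exists>\<alpha>\<in>carrier G. \<forall>x\<in>F. \<alpha> x = \<phi> (?l x)" "\<exists>\<beta>\<in>carrier G. \<forall>x\<in>F. \<beta> x = \<phi> (?r x)"
    by (simp_all add: extension[OF F])
  then obtain \<alpha> \<beta> where \<alpha>: "\<alpha> \<in> carrier G" "\<And>x. x \<in> F \<Longrightarrow> \<alpha> x = \<phi> (?l x)"
    and \<beta>: "\<beta> \<in> carrier G" "\<And>x. x \<in> F \<Longrightarrow> \<beta> x = \<phi> (?r x)"
    by blast
  interpret G: group G by (rule group_isom_group)
  let ?k = "inv\<^bsub>G\<^esub> \<alpha> \<otimes>\<^bsub>G\<^esub> \<beta>"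
  have k: "?k \<in> carrier G" using \<alpha>(1) \<beta>(1) by simp
  have \<alpha>k: "\<alpha> (?k x) = \<phi> (?r x)" if "x \<in> F" for x
  proof -
    have "x \<in> H" "\<beta> x \<in> H" using that FH isom_in[OF \<beta>(1)] by auto
    then show ?thesis
      using mult_isom_group[OF isom_inv_closed[OF \<alpha>(1)] \<beta>(1), of x]
        isom_inv_right[OF \<alpha>(1), of "\<beta> x"] \<beta>(2)[OF that] by simp
  qed
  have kH: "?k x \<in> H" if "x \<in> F" for x using isom_in[OF k] that FH by auto
  show ?thesis
  proof (rule that[of ?k])
    have "?k a = a" if "a \<in> A" for a
    proof -
      have "a \<in> F" using that \<open>A \<subseteq> F\<close> by auto
      moreover from this have "\<alpha> (?k a) = \<alpha> a" using \<alpha>k \<alpha>(2) that by simp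
      ultimately show ?thesis using isom_eq_iff[OF \<alpha>(1)] kH FH by auto
    qed
    then show "?k \<in> stab A" using k by (simp add: pointwise_stabilizer_def)
    have "\<alpha> ` (F \<union> ?k ` F) = \<phi> ` ?X"
      unfolding X_eq image_Un image_image
      by (intro arg_cong2[of _ _ _ _ "(\<union>)"] image_cong refl \<alpha>(2) \<alpha>k)
    then have "(inv\<^bsub>G\<^esub> \<alpha>) ` \<phi> ` ?X = (\<lambda>x. (inv\<^bsub>G\<^esub> \<alpha>) (\<alpha> x)) ` (F \<union> ?k ` F)"
      by (metis image_image)
    also have "\<dots> = (\<lambda>x. x) ` (F \<union> ?k ` F)"
      by (rule image_cong) (use isom_inv_left[OF \<alpha>(1)] kH FH in auto)
    finally show "delta_closed \<delta> H d (F \<union> ?k ` F)"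
      using delta_closed_isom_image[OF isom_inv_closed[OF \<alpha>(1)] Metric_space_axioms \<phi>(3)] by simp
    fix b c assume bc: "b \<in> F" "c \<in> F"
    obtain a where a: "a \<in> A" "?e (?l b) (?r c) = ?e (?l b) (?l a) + ?e (?l a) (?r c)"
      using F.amalgam_between[OF AF bc] by blast
    have dk: "d x (?k c) = ?e (?l x) (?r c)" if "x \<in> F" for x
    proof -
      have "d x (?k c) = d (\<alpha> x) (\<alpha> (?k c))" using isom_dist[OF \<alpha>(1)] that FH kH[OF bc(2)] by auto
      then show ?thesis using \<alpha>(2)[OF that] \<alpha>k[OF bc(2)] \<phi>d[OF lX[OF that] rX[OF bc(2)]] by simp
    qed
    have "a \<in> F" using a \<open>A \<subseteq> F\<close> by auto
    with a(2) have "d b (?k c) = d b a + d a (?k c)" unfolding dk[OF bc(1)] dk[OF \<open>a \<in> F\<close>] by simp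
    with a(1) show "\<exists>a\<in>A. d b (?k c) = d b a + d a (?k c)" by blast
  qed
qed

text \<open>On \<open>D\<close> and \<open>k D\<close> the map acting as \<open>g\<close> and as the
  conjugate of \<open>g'\<close> by \<open>k\<close> is well defined and isometric, and its domain
  and image are closed; homogeneity extends it.\<close>

lemma joint_extension:
  assumes A: "delta_closed \<delta> H d A" and D: "finite D" "delta_closed \<delta> H d D" "A \<subseteq> D"
    and g: "g \<in> stab A" and g': "g' \<in> stab A"
  obtains k h where "k \<in> stab A" "h \<in> stab A" "\<And>x. x \<in> D \<Longrightarrow> h x = g x"
    "\<And>x. x \<in> D \<Longrightarrow> h (k x) = k (g' x)"
proof -
  note gG = pointwise_stabilizerD[OF g] and gG' = pointwise_stabilizerD[OF g']
  have DH: "D \<subseteq> H" by (rule delta_closed_subsetD[OF D(2)])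
  \<comment> \<open>Including the images of \<open>D\<close> makes \<open>k\<close> independent for
    them too; this is used for the closed image and for the inverses in
    \<open>dist_mixed\<close>.\<close>
  have "finite (D \<union> g ` D \<union> g' ` D)" "D \<union> g ` D \<union> g' ` D \<subseteq> H"
    using D(1) DH isom_in[OF gG(1)] isom_in[OF gG'(1)] by auto
  then obtain F where F: "finite F" "delta_closed \<delta> H d F" "D \<union> g ` D \<union> g' ` D \<subseteq> F"
    by (rule finite_closed_superset)
  have FH: "F \<subseteq> H" by (rule delta_closed_subsetD[OF F(2)])
  have AF: "A \<subseteq> F" "A \<subseteq> H" using D(3) F(3) DH by auto
  obtain k where k: "k \<in> stab A" and clk: "delta_closed \<delta> H d (F \<union> k ` F)"
    and bet: "\<And>b c. b \<in> F \<Longrightarrow> c \<in> F \<Longrightarrow> \<exists>a\<in>A. d b (k c) = d b a + d a (k c)"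
    using independent_copy[OF A F(1,2) AF(1)] by blast
  note kG = pointwise_stabilizerD[OF k]
  have kH: "k x \<in> H" if "x \<in> F" for x using isom_in[OF kG(1)] that FH by auto
  have FD: "x \<in> F" "g x \<in> F" "g' x \<in> F" if "x \<in> D" for x using F(3) that by auto
  have Un: "delta_closed \<delta> H d (E \<union> k ` E')"
    if E: "delta_closed \<delta> H d E" "A \<subseteq> E" "E \<subseteq> F" and E': "delta_closed \<delta> H d E'" "A \<subseteq> E'" "E' \<subseteq> F" for E E'
  proof (rule delta_closed_trans[OF clk Metric_space.delta_closed_Un[OF _ refl, where A = A]])
    show "Metric_space (F \<union> k ` F) d" by (rule subspace) (use FH kH in auto)
    show "delta_closed \<delta> F d E" by (rule delta_closed_subset[OF E(1,3) FH])
    show "delta_closed \<delta> (k ` F) d (k ` E')"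
      by (rule delta_closed_subset[OF delta_closed_isom_image[OF kG(1) Metric_space_axioms E'(1)]])
        (use E' kH in auto)
    show "A \<subseteq> E" "A \<subseteq> k ` E'" using E(2) E'(2) kG(2) by force+
    show "\<exists>a\<in>A. d b c = d b a + d a c" if "b \<in> F" "c \<in> k ` F" for b c
      using that bet by auto
  qed
  have dA: "d a (u x) = d a x" if "u \<in> stab A" "a \<in> A" "x \<in> H" for u a x
    using isom_dist[OF pointwise_stabilizerD(1)[OF that(1)], of a x] pointwise_stabilizerD(2)[OF that(1,2)]
      that AF by auto
  \<comment> \<open>All maps involved fix the point \<open>a\<close> of \<open>A\<close> between
    \<open>b\<close> and \<open>k c\<close>, so the route through \<open>a\<close> keeps its
    length.\<close>
  have le: "d (v b) (k (w c)) \<le> d b (k c)"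
    if vw: "v \<in> stab A" "w \<in> stab A" and bc: "b \<in> F" "c \<in> F" for v w b c
  proof -
    obtain a where a: "a \<in> A" "d b (k c) = d b a + d a (k c)" using bet[OF bc] by blast
    have mem: "a \<in> H" "b \<in> H" "c \<in> H" "v b \<in> H" "w c \<in> H" "k (w c) \<in> H"
      using a AF bc FH isom_in pointwise_stabilizerD(1) vw k by (metis subsetD)+
    have "d a (v b) = d a b" "d a (k (w c)) = d a (w c)" "d a (w c) = d a c" "d a (k c) = d a c"
      using dA vw k a(1) mem by auto
    then show ?thesis using a(2) triangle[OF mem(4,1,6)] commute[of a b] commute[of a "v b"] by simp
  qed
  have dist_mixed: "d (g b) (k (g' c)) = d b (k c)" if bc: "b \<in> D" "c \<in> D" for b c
  proof (rule antisym)
    show "d (g b) (k (g' c)) \<le> d b (k c)" using le[OF g g' FD(1)[OF bc(1)] FD(1)[OF bc(2)]] .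
    \<comment> \<open>The reverse inequality is \<open>le\<close> for the inverse maps at the points
      \<open>g b\<close> and \<open>g' c\<close>.\<close>
    have inv: "inv\<^bsub>G\<^esub> g \<in> stab A" "inv\<^bsub>G\<^esub> g' \<in> stab A"
      using subgroup.m_inv_closed[OF subgroup_pointwise_stabilizer[OF AF(2)]] g g' by auto
    show "d b (k c) \<le> d (g b) (k (g' c))"
      using le[OF inv FD(2)[OF bc(1)] FD(3)[OF bc(2)]]
        isom_inv_left[OF gG(1), of b] isom_inv_left[OF gG'(1), of c] bc DH by (simp add: subset_iff)
  qed
  define f where "f x = (if x \<in> D then g x else k (g' ((inv\<^bsub>G\<^esub> k) x)))" for x
  have fD: "f x = g x" if "x \<in> D" for x using that by (simp add: f_def)
  have fk: "f (k x) = k (g' x)" if x: "x \<in> D" for x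
  proof (cases "k x \<in> D")
    case True
    \<comment> \<open>A point of both \<open>D\<close> and \<open>k D\<close> lies in
      \<open>A\<close>: the point of \<open>A\<close> between it and itself can only be that point.
      There both prescriptions are the identity.\<close>
    obtain a where a: "a \<in> A" "d (k x) (k x) = d (k x) a + d a (k x)"
      using bet[OF FD(1)[OF True] FD(1)[OF x]] by blast
    have mem: "a \<in> H" "k x \<in> H" "x \<in> H" using a AF True DH x by auto
    have "d (k x) (k x) = 0" using mem by simp
    then have "d (k x) a = 0" using a(2) nonneg[of "k x" a] nonneg[of a "k x"] by linarith
    then have "k x = a" using zero mem by blast
    moreover from this have "x = a" using isom_eq_iff[OF kG(1) mem(3,1)] kG(2)[OF a(1)] by simp
    ultimately show ?thesis using fD[OF True] gG(2) gG'(2) a(1) by simp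
  next
    case False
    then show ?thesis using isom_inv_left[OF kG(1), of x] x DH by (auto simp: f_def)
  qed
  have imf: "f ` (D \<union> k ` D) = g ` D \<union> k ` (g' ` D)"
    using fD fk by (simp add: image_Un image_image)
  have cl: "delta_closed \<delta> H d (D \<union> k ` D)" using Un[OF D(2,3) _ D(2,3)] F(3) by simp
  have "A \<subseteq> g ` D" "A \<subseteq> g' ` D" using gG(2) gG'(2) D(3) by force+
  then have cl': "delta_closed \<delta> H d (f ` (D \<union> k ` D))"
    unfolding imf using F(3)
    by (intro Un delta_closed_isom_image[OF gG(1) Metric_space_axioms D(2)]
        delta_closed_isom_image[OF gG'(1) Metric_space_axioms D(2)]) auto
  have kk: "d (k (g' x)) (k (g' y)) = d (k x) (k y)" if "x \<in> D" "y \<in> D" for x y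
  proof -
    have "x \<in> H" "y \<in> H" "g' x \<in> H" "g' y \<in> H" using that DH isom_in[OF gG'(1)] by auto
    then show ?thesis using isom_dist[OF kG(1)] isom_dist[OF gG'(1)] by simp
  qed
  have gg: "d (g x) (g y) = d x y" if "x \<in> D" "y \<in> D" for x y
    using isom_dist[OF gG(1)] that DH by auto
  have "isometric_on (D \<union> k ` D) d d f"
    unfolding isometric_on_def
  proof (intro ballI)
    fix x y assume "x \<in> D \<union> k ` D" "y \<in> D \<union> k ` D"
    then consider "x \<in> D" "y \<in> D" | b where "x \<in> D" "y = k b" "b \<in> D"
      | b where "y \<in> D" "x = k b" "b \<in> D" | b c where "x = k b" "y = k c" "b \<in> D" "c \<in> D"
      by blast
    then show "d (f x) (f y) = d x y"
    proof cases
      case 3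
      then show ?thesis
        using dist_mixed[OF 3(1,3)] fD fk commute[of "f x"] commute[of x] by simp
    qed (simp_all add: fD fk dist_mixed kk gg)
  qed
  then obtain h where h: "h \<in> carrier G" "\<And>x. x \<in> D \<union> k ` D \<Longrightarrow> h x = f x"
    using extension[OF _ cl _ cl'] D(1) by (metis finite_UnI finite_imageI)
  have "h \<in> stab A" using h fD gG(2) D(3) by (auto simp: pointwise_stabilizer_def)
  then show ?thesis using that[of k h] k h(2) fD fk by simp
qed

section \<open>Construction of a generic element\<close>

text \<open>Restrictions to a finite \<open>C n\<close> form a countable set, as \<open>H\<close> is
  countable. \<open>Q\<close> picks one element of \<open>S\<close> for each of them, over all
  \<open>n\<close>.\<close>

lemma countable_dense_subset:
  assumes "S \<subseteq> carrier G"
  obtains Q where "countable Q" "Q \<subseteq> S"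
    "\<And>h D. h \<in> S \<Longrightarrow> finite D \<Longrightarrow> D \<subseteq> H \<Longrightarrow> \<exists>q\<in>Q. \<forall>x\<in>D. q x = h x"
proof -
  obtain C where C: "incseq C" "\<And>n::nat. finite (C n)" "\<And>n. delta_closed \<delta> H d (C n)" "(\<Union>n. C n) = H"
    using exhaustion by blast
  define r where "r n h = restrict h (C n)" for n and h :: "'a \<Rightarrow> 'a"
  define Q where "Q = (\<Union>n. inv_into S (r n) ` r n ` S)"
  have "r n h \<in> C n \<rightarrow>\<^sub>E H" if "h \<in> S" for n h
    using isom_in[of h H d] that \<open>S \<subseteq> carrier G\<close> C(4) by (auto simp: r_def)
  moreover have "countable (C n \<rightarrow>\<^sub>E H)" for n
    using is_H by (intro countable_PiE C(2)) (simp add: is_H_delta_def)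
  ultimately have "countable (r n ` S)" for n
    by (meson countable_subset image_subsetI)
  then have "countable Q" unfolding Q_def by auto
  moreover have "Q \<subseteq> S" unfolding Q_def by (auto intro: inv_into_into)
  moreover have "\<exists>q\<in>Q. \<forall>x\<in>D. q x = h x" if h: "h \<in> S" and D: "finite D" "D \<subseteq> H" for h D
  proof -
    obtain n where n: "D \<subseteq> C n" using finite_subset_exhaustion[OF C(1,4) D] by blast
    let ?q = "inv_into S (r n) (r n h)"
    have "r n ?q = r n h" using h by (simp add: f_inv_into_f)
    then have "?q x = h x" if "x \<in> D" for x
      using that n unfolding r_def by (metis restrict_apply' subsetD)
    moreover have "?q \<in> Q" unfolding Q_def using h by blast
    ultimately show ?thesis by blast
  qed
  ultimately show ?thesis by (rule that)
qed

text \<open>Only the values of \<open>g n\<close> on \<open>D n\<close> persist. Surjectivity of the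
  limit does not follow from that of the \<open>g n\<close>, hence the hypothesis
  \<open>onto\<close>.\<close>

lemma limit_isometry:
  assumes mono: "incseq D" and exh: "(\<Union>n::nat. D n) = H"
    and g: "\<And>n. g n \<in> carrier G" "\<And>n x. x \<in> D n \<Longrightarrow> g (Suc n) x = g n x"
    and onto: "H \<subseteq> (\<Union>n. g n ` D n)"
  obtains h where "h \<in> carrier G" "\<And>n x. x \<in> D n \<Longrightarrow> h x = g n x"
proof -
  have stable: "g m x = g n x" if "n \<le> m" "x \<in> D n" for n m x
    using that(1)
  proof (induction m rule: dec_induct)
    case (step m)
    then show ?case using g(2)[of x m] that(2) incseqD[OF mono, of n m] by auto
  qed simp
  define h where "h = (\<lambda>x\<in>H. g (LEAST n. x \<in> D n) x)"
  have h: "h x = g n x" if "x \<in> D n" for n x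
  proof -
    have "(LEAST n. x \<in> D n) \<le> n" "x \<in> D (LEAST n. x \<in> D n)"
      using that by (auto intro: Least_le LeastI)
    then have "g n x = g (LEAST n. x \<in> D n) x" by (rule stable)
    moreover have "x \<in> H" using exh that by blast
    ultimately show ?thesis by (simp add: h_def)
  qed
  have DH: "x \<in> H" if "x \<in> D n" for x n using that exh by blast
  have iso: "isometric_on H d d h"
    unfolding isometric_on_def
  proof (intro ballI)
    fix x y assume "x \<in> H" "y \<in> H"
    then obtain n m where "x \<in> D n" "y \<in> D m" using exh by blast
    then have "x \<in> D (max n m)" "y \<in> D (max n m)"
      using incseqD[OF mono, of n "max n m"] incseqD[OF mono, of m "max n m"] by auto
    then show "d (h x) (h y) = d x y"
      using h isom_dist[OF g(1)] DH by metis
  qed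
  have "h ` H = H"
  proof (intro equalityI subsetI)
    fix y assume "y \<in> h ` H"
    then obtain x n where x: "x \<in> D n" "y = h x" using exh by blast
    then show "y \<in> H" using h[OF x(1)] isom_in[OF g(1)] DH[OF x(1)] by simp
  next
    fix y assume "y \<in> H"
    then obtain n x where x: "x \<in> D n" "y = g n x" using onto by blast
    then have "y = h x" using h by simp
    then show "y \<in> h ` H" using DH[OF x(1)] by blast
  qed
  moreover from this have "inj_on h H" using isometric_on_inj[OF iso] Metric_space_axioms by simp
  ultimately have "h \<in> carrier G"
    using iso by (simp add: carrier_isom_group Bij_def bij_betw_def h_def)
  with h that show ?thesis by blast
qed

text \<open>The equation \<open>g (k x) = k (q x)\<close> says that conjugating \<open>g\<close> by
  the inverse of \<open>k\<close> gives a map agreeing with \<open>q\<close> at \<open>x\<close>. A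
  back-and-forth construction meets countably many such demands one at a time.\<close>

lemma generic_element:
  assumes A: "finite A" "delta_closed \<delta> H d A"
  obtains g where "g \<in> stab A"
    "\<And>q D. q \<in> stab A \<Longrightarrow> finite D \<Longrightarrow> D \<subseteq> H \<Longrightarrow> \<exists>k\<in>stab A. \<forall>x\<in>D. g (k x) = k (q x)"
proof -
  let ?S = "stab A"
  have AH: "A \<subseteq> H" by (rule delta_closed_subsetD[OF A(2)])
  have SG: "?S \<subseteq> carrier G" by (auto simp: pointwise_stabilizer_def)
  have SH: "q x \<in> H" if "q \<in> ?S" "x \<in> H" for q x
    using isom_in[OF pointwise_stabilizerD(1)[OF that(1)] that(2)] .
  obtain C where C: "incseq C" "\<And>n::nat. finite (C n)" "\<And>n. delta_closed \<delta> H d (C n)" "(\<Union>n. C n) = H"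
    using exhaustion by blast
  obtain Q where Q: "countable Q" "Q \<subseteq> ?S"
    "\<And>h D. h \<in> ?S \<Longrightarrow> finite D \<Longrightarrow> D \<subseteq> H \<Longrightarrow> \<exists>q\<in>Q. \<forall>x\<in>D. q x = h x"
    using countable_dense_subset[OF SG] by blast
  have one: "\<one>\<^bsub>G\<^esub> \<in> ?S" by (rule subgroup.one_closed[OF subgroup_pointwise_stabilizer[OF AH]])
  have Qne: "Q \<times> (UNIV :: nat set) \<noteq> {}" using Q(3)[OF one, of "{}"] by auto
  have Qc: "countable (Q \<times> (UNIV :: nat set))" using Q(1) by simp
  \<comment> \<open>Enumerates the tasks \<open>(q, m)\<close>: plant a conjugate of
    \<open>q\<close> on the translate of \<open>C m\<close>.\<close>
  define t where "t = from_nat_into (Q \<times> (UNIV :: nat set))"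
  have range_t: "range t = Q \<times> UNIV" unfolding t_def by (rule range_from_nat_into[OF Qne Qc])
  have t: "fst (t n) \<in> ?S" for n using range_t Q(2) by (metis mem_Times_iff rangeI subsetD)
  \<comment> \<open>A state is an isometry together with the finite closed set on which its values
    are already committed.\<close>
  define P where "P s \<longleftrightarrow> fst s \<in> ?S \<and> finite (snd s) \<and> delta_closed \<delta> H d (snd s)"
    for s :: "('a \<Rightarrow> 'a) \<times> 'a set"
  \<comment> \<open>Step \<open>n\<close> keeps the commitments, puts \<open>C n\<close> into the
    committed domain and image, and performs task \<open>t n\<close>.\<close>
  define R where "R n s s' \<longleftrightarrow> snd s \<subseteq> snd s' \<and> (\<forall>x\<in>snd s. fst s' x = fst s x) \<and> C n \<subseteq> snd s' \<and>
      C n \<subseteq> fst s' ` snd s' \<and>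
      (\<exists>k\<in>?S. \<forall>x\<in>C (snd (t n)). k x \<in> snd s' \<and> fst s' (k x) = k (fst (t n) x))"
    for n and s s' :: "('a \<Rightarrow> 'a) \<times> 'a set"
  have "\<exists>s'. P s' \<and> R n s s'" if s: "P s" for n s
  proof -
    obtain g E where [simp]: "s = (g, E)" by fastforce
    have gE: "g \<in> ?S" "finite E" "delta_closed \<delta> H d E" using s by (auto simp: P_def)
    let ?m = "snd (t n)"
    have CH: "C i \<subseteq> H" for i using C(4) by blast
    have EH: "E \<subseteq> H" by (rule delta_closed_subsetD[OF gE(3)])
    have "finite (A \<union> E \<union> C ?m)" "A \<union> E \<union> C ?m \<subseteq> H" using A(1) gE(2) C(2) AH EH CH by auto
    then obtain D where D: "finite D" "delta_closed \<delta> H d D" "A \<union> E \<union> C ?m \<subseteq> D"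
      by (rule finite_closed_superset)
    have AD: "A \<subseteq> D" using D(3) by simp
    obtain k h where kh: "k \<in> ?S" "h \<in> ?S" "\<And>x. x \<in> D \<Longrightarrow> h x = g x"
        "\<And>x. x \<in> D \<Longrightarrow> h (k x) = k (fst (t n) x)"
      using joint_extension[OF A(2) D(1,2) AD gE(1) t] by blast
    have hG: "h \<in> carrier G" using SG kh by blast
    let ?i = "inv\<^bsub>G\<^esub> h"
    have DH: "D \<subseteq> H" by (rule delta_closed_subsetD[OF D(2)])
    \<comment> \<open>The preimage of \<open>C n\<close> secures the image condition of
      \<open>R\<close>; the translate of \<open>C ?m\<close> commits the planted conjugate.\<close>
    have "finite (E \<union> C n \<union> ?i ` C n \<union> k ` C ?m)" using gE(2) C(2) by simp
    moreover have "E \<union> C n \<union> ?i ` C n \<union> k ` C ?m \<subseteq> H"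
      using EH CH SH[OF kh(1)] isom_in[OF isom_inv_closed[OF hG]] by blast
    ultimately obtain E' where E': "finite E'" "delta_closed \<delta> H d E'"
        "E \<union> C n \<union> ?i ` C n \<union> k ` C ?m \<subseteq> E'"
      by (rule finite_closed_superset)
    have "C n \<subseteq> h ` E'"
    proof
      fix x assume x: "x \<in> C n"
      then have "h (?i x) = x" using isom_inv_right[OF hG] CH by blast
      moreover have "?i x \<in> E'" using x E'(3) by blast
      ultimately show "x \<in> h ` E'" by (metis imageI)
    qed
    moreover have "\<exists>k\<in>?S. \<forall>x\<in>C ?m. k x \<in> E' \<and> h (k x) = k (fst (t n) x)"
      using kh D(3) E'(3) by (intro bexI[of _ k]) auto
    ultimately have "P (h, E') \<and> R n s (h, E')"
      using kh(2,3) E' D(3) by (auto simp: P_def R_def)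
    then show ?thesis by blast
  qed
  moreover have "P (\<one>\<^bsub>G\<^esub>, A)" using one A by (simp add: P_def)
  ultimately obtain f where f: "\<And>n. P (f n)" "\<And>n. R n (f n) (f (Suc n))"
    using dependent_nat_choice[of "\<lambda>_. P" R] by blast
  define g D where "g n = fst (f n)" and "D n = snd (f n)" for n
  have gS: "g n \<in> ?S" and clD: "delta_closed \<delta> H d (D n)" for n
    using f(1)[of n] by (auto simp: P_def g_def D_def)
  have step: "D n \<subseteq> D (Suc n)" "\<And>x. x \<in> D n \<Longrightarrow> g (Suc n) x = g n x" "C n \<subseteq> D (Suc n)"
    "C n \<subseteq> g (Suc n) ` D (Suc n)"
    "\<exists>k\<in>?S. \<forall>x\<in>C (snd (t n)). k x \<in> D (Suc n) \<and> g (Suc n) (k x) = k (fst (t n) x)" for n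
    using f(2)[of n] unfolding R_def g_def D_def by blast+
  have incD: "incseq D" by (rule incseq_SucI) (rule step(1))
  have "(\<Union>n. D n) = H"
    using step(3) C(4) delta_closed_subsetD[OF clD] by blast
  moreover have "g n \<in> carrier G" for n using gS SG by blast
  moreover have "H \<subseteq> (\<Union>n. g n ` D n)" using step(4) C(4) by blast
  ultimately obtain h where h: "h \<in> carrier G" "\<And>n x. x \<in> D n \<Longrightarrow> h x = g n x"
    using limit_isometry[of D g, OF incD _ _ step(2)] by blast
  have "h a = a" if a: "a \<in> A" for a
  proof -
    obtain n where "a \<in> D n" using a AH \<open>(\<Union>n. D n) = H\<close> by blast
    then show ?thesis using h(2) pointwise_stabilizerD(2)[OF gS a] by simp
  qed
  then have "h \<in> ?S" using h(1) by (simp add: pointwise_stabilizer_def)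
  moreover have "\<exists>k\<in>?S. \<forall>x\<in>D. h (k x) = k (q x)" if q: "q \<in> ?S" and D: "finite D" "D \<subseteq> H" for q D
  proof -
    \<comment> \<open>Only the values on \<open>D\<close> matter, so \<open>q\<close> may be
      replaced by an element of \<open>Q\<close>, whose task on some \<open>C m\<close> containing
      \<open>D\<close> was performed.\<close>
    obtain q' where q': "q' \<in> Q" "\<forall>x\<in>D. q' x = q x" using Q(3)[OF q D] by blast
    obtain m where m: "D \<subseteq> C m" using finite_subset_exhaustion[OF C(1,4) D] by blast
    obtain n where n: "t n = (q', m)" using range_t q'(1) by (metis UNIV_I SigmaI imageE)
    show ?thesis using step(5)[of n] h(2) q'(2) m unfolding n by (metis fst_conv snd_conv subsetD)
  qed
  ultimately show ?thesis using that by blast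
qed

section \<open>Neighbourhoods and density in the stabilizer\<close>

lemma openin_agree:
  assumes "finite D" "delta_closed \<delta> H d D"
  shows "openin (isom_topology \<delta> H d) {f \<in> carrier G. \<forall>x\<in>D. f x = h x}"
  unfolding openin_isom_topology[OF is_H]
  using assms coset_pointwise_stabilizer[OF delta_closed_subsetD[OF assms(2)], of _ d]
  by (intro conjI ballI exI[of _ D]) auto

lemma topspace_isom_topology: "topspace (isom_topology \<delta> H d) = carrier G"
proof (rule antisym)
  show "topspace (isom_topology \<delta> H d) \<subseteq> carrier G"
    using openin_isom_topology[OF is_H] openin_topspace by blast
  obtain D where "finite D" "delta_closed \<delta> H d D"
    using finite_closed_superset[of "{}"] by auto
  then show "carrier G \<subseteq> topspace (isom_topology \<delta> H d)"
    using openin_subset[OF openin_agree] by fastforce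
qed

lemma dense_conjugacy_class_stab:
  assumes A: "finite A" "delta_closed \<delta> H d A"
  shows "has_dense_conjugacy_class (G\<lparr>carrier := stab A\<rparr>)
    (subtopology (isom_topology \<delta> H d) (stab A))"
proof -
  interpret G: group G by (rule group_isom_group)
  let ?S = "stab A" and ?T = "isom_topology \<delta> H d"
  have AH: "A \<subseteq> H" by (rule delta_closed_subsetD[OF A(2)])
  interpret S: subgroup ?S G by (rule subgroup_pointwise_stabilizer[OF AH])
  obtain g where g: "g \<in> ?S"
    "\<And>q D. q \<in> ?S \<Longrightarrow> finite D \<Longrightarrow> D \<subseteq> H \<Longrightarrow> \<exists>k\<in>?S. \<forall>x\<in>D. g (k x) = k (q x)"
    using generic_element[OF A] by blast
  let ?K = "conjugacy_class (G\<lparr>carrier := ?S\<rparr>) g"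
  \<comment> \<open>Inverses in the stabilizer are inverses in \<open>G\<close>.\<close>
  have K: "?K = {k \<otimes>\<^bsub>G\<^esub> g \<otimes>\<^bsub>G\<^esub> inv\<^bsub>G\<^esub> k | k. k \<in> ?S}"
    unfolding conjugacy_class_def
    by (intro Collect_cong ex_cong1) (auto simp: G.m_inv_consistent[OF S.subgroup_axioms])
  have "subtopology ?T ?S closure_of ?K = ?S"
  proof (rule antisym)
    show "subtopology ?T ?S closure_of ?K \<subseteq> ?S"
      using closure_of_subset_topspace[of "subtopology ?T ?S" ?K] by auto
    show "?S \<subseteq> subtopology ?T ?S closure_of ?K"
    proof
      fix q assume q: "q \<in> ?S"
      have "\<exists>y. y \<in> ?K \<and> y \<in> U" if U: "q \<in> U" "openin (subtopology ?T ?S) U" for U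
      proof -
        obtain V where V: "openin ?T V" "U = V \<inter> ?S" using U(2) by (auto simp: openin_subtopology)
        then obtain D where D: "finite D" "delta_closed \<delta> H d D" "q <#\<^bsub>G\<^esub> stab D \<subseteq> V"
          using openin_isom_topology[OF is_H, of V] U(1) by blast
        have DH: "D \<subseteq> H" by (rule delta_closed_subsetD[OF D(2)])
        obtain k where k: "k \<in> ?S" "\<forall>x\<in>D. g (k x) = k (q x)" using g(2)[OF q D(1) DH] by blast
        \<comment> \<open>The conjugating element is the inverse of \<open>k\<close>, whence the
          double inverse.\<close>
        let ?c = "inv\<^bsub>G\<^esub> k \<otimes>\<^bsub>G\<^esub> g \<otimes>\<^bsub>G\<^esub> inv\<^bsub>G\<^esub> (inv\<^bsub>G\<^esub> k)"
        have cK: "?c \<in> ?K" unfolding K using k(1) by blast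
        have cS: "?c \<in> ?S" using k(1) g(1) by simp
        have c: "?c = inv\<^bsub>G\<^esub> k \<otimes>\<^bsub>G\<^esub> g \<otimes>\<^bsub>G\<^esub> k" using k(1) by (simp add: S.mem_carrier)
        have kG: "k \<in> carrier G" "g \<in> carrier G" using k(1) g(1) by simp_all
        have "?c x = q x" if x: "x \<in> D" for x
        proof -
          have mem: "x \<in> H" "k x \<in> H" "q x \<in> H"
            using x DH isom_in[OF kG(1)] isom_in[OF S.mem_carrier[OF q]] by auto
          have "?c x = (inv\<^bsub>G\<^esub> k) (g (k x))"
            unfolding c using mem kG by (simp add: mult_isom_group)
          also have "\<dots> = q x" using k(2) x isom_inv_left[OF kG(1) mem(3)] by simp
          finally show ?thesis .
        qed
        then have "?c \<in> V"
          using D(3) coset_pointwise_stabilizer[OF DH S.mem_carrier[OF q]] cS by auto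
        then show ?thesis using cK cS V(2) by blast
      qed
      then show "q \<in> subtopology ?T ?S closure_of ?K"
        using q by (auto simp: in_closure_of topspace_isom_topology)
    qed
  qed
  then show ?thesis unfolding has_dense_conjugacy_class_def using g(1) by auto
qed

section \<open>Translations and the failure of density in the full group\<close>

text \<open>A fixed point \<open>x\<close> is equidistant from \<open>p0\<close>, \<open>p1\<close>,
  \<open>p2\<close>. Pairing \<open>x\<close> with \<open>p1\<close> in the four point condition
  then yields \<open>2 * D \<le> D + 2 * \<delta>\<close>.\<close>

lemma translation_no_fixed_point:
  assumes p: "p0 \<in> H" "p1 \<in> H" "p2 \<in> H" and D: "d p0 p1 = D" "d p1 p2 = D" "d p0 p2 = 2 * D" "D > 2 * \<delta>"
    and h: "h \<in> carrier G" "h p0 = p1" "h p1 = p2" and x: "x \<in> H"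
  shows "h x \<noteq> x"
proof
  assume "h x = x"
  then have "d x p1 = d x p0" "d x p2 = d x p1"
    using isom_dist[OF h(1) x p(1)] isom_dist[OF h(1) x p(2)] h by auto
  moreover have "d x p1 + d p0 p2 \<le> max (d x p0 + d p2 p1) (d x p2 + d p0 p1) + 2 * \<delta>"
    using is_H x p unfolding is_H_delta_def hyperbolic_def by (metis commute)
  ultimately show False using D commute[of p2 p1] by simp
qed

text \<open>Three equally spaced points of the real line, with natural spacing to keep distances
  rational, embedded by universality. Truncation at the middle point is the gate map onto each end
  pair.\<close>

lemma translation_points:
  obtains p0 p1 p2 D where "p0 \<in> H" "p1 \<in> H" "p2 \<in> H" "d p0 p1 = D" "d p1 p2 = D" "d p0 p2 = 2 * D"
    "D > 2 * \<delta>" "delta_closed \<delta> H d {p0, p1}" "delta_closed \<delta> H d {p1, p2}"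
proof -
  obtain D :: nat where D: "real D > 2 * \<delta>" using reals_Archimedean2 by blast
  then have D0: "real D > 0" using nonneg_delta by linarith
  let ?N = "{0, D, 2 * D}" and ?e = "\<lambda>x y :: nat. \<bar>real x - real y\<bar>"
  have N: "Metric_space ?N ?e" by unfold_locales auto
  have "hyperbolic \<delta> ?N ?e"
    unfolding hyperbolic_def using nonneg_delta by (intro ballI) linarith
  moreover have "rational_distances ?N ?e" by (auto simp: rational_distances_def)
  ultimately obtain f where f: "f ` ?N \<subseteq> H" "isometric_on ?N ?e d f" "delta_closed \<delta> H d (f ` ?N)"
    using embedding[OF N, of thesis] by simp
  have d: "d (f 0) (f D) = D" "d (f D) (f (2 * D)) = D" "d (f 0) (f (2 * D)) = 2 * real D"
    using f(2) by (auto simp: isometric_on_def)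
  have cl: "delta_closed \<delta> H d (f ` A)" if "delta_closed \<delta> ?N ?e A" for A
    using delta_closed_trans[OF f(3) Metric_space.delta_closed_image[OF N f(2) subspace[OF f(1)] that]] .
  have "delta_closed \<delta> ?N ?e {0, D}"
    by (rule Metric_space.delta_closedI[OF N, where g = "\<lambda>x. min x D"])
      (use D0 nonneg_delta in \<open>auto simp: is_gate_def\<close>)
  moreover have "delta_closed \<delta> ?N ?e {D, 2 * D}"
    by (rule Metric_space.delta_closedI[OF N, where g = "\<lambda>x. max x D"])
      (use D0 nonneg_delta in \<open>auto simp: is_gate_def\<close>)
  ultimately show ?thesis
    using that[OF _ _ _ d] f(1) D cl[of "{0, D}"] cl[of "{D, 2 * D}"] by auto
qed

lemma no_dense_conjugacy_class: "\<not> has_dense_conjugacy_class G (isom_topology \<delta> H d)"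
proof
  let ?T = "isom_topology \<delta> H d"
  assume "has_dense_conjugacy_class G ?T"
  then obtain g where g: "g \<in> carrier G" "?T closure_of conjugacy_class G g = carrier G"
    unfolding has_dense_conjugacy_class_def by blast
  \<comment> \<open>A dense class meets the basic neighbourhood of \<open>h\<close> given by
    agreement on \<open>D\<close>; undoing the conjugation yields \<open>k\<close>.\<close>
  have meets: "\<exists>k\<in>carrier G. \<forall>x\<in>D. g (k x) = k (h x)"
    if D: "finite D" "delta_closed \<delta> H d D" and h: "h \<in> carrier G" for D h
  proof -
    let ?U = "{f \<in> carrier G. \<forall>x\<in>D. f x = h x}"
    have "h \<in> ?T closure_of conjugacy_class G g" using g(2) h by simp
    moreover have "h \<in> ?U" using h by simp
    ultimately have "\<exists>y. y \<in> conjugacy_class G g \<and> y \<in> ?U"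
      using openin_agree[OF D, of h] unfolding in_closure_of by (metis (lifting))
    then obtain y where y: "y \<in> conjugacy_class G g" "y \<in> ?U" by blast
    then obtain l where l: "l \<in> carrier G" "y = l \<otimes>\<^bsub>G\<^esub> g \<otimes>\<^bsub>G\<^esub> inv\<^bsub>G\<^esub> l"
      unfolding conjugacy_class_def by blast
    interpret G: group G by (rule group_isom_group)
    have "g ((inv\<^bsub>G\<^esub> l) x) = (inv\<^bsub>G\<^esub> l) (h x)" if x: "x \<in> D" for x
    proof -
      have xH: "x \<in> H" using x delta_closed_subsetD[OF D(2)] by blast
      have mem: "(inv\<^bsub>G\<^esub> l) x \<in> H" "g ((inv\<^bsub>G\<^esub> l) x) \<in> H"
        using isom_in[OF isom_inv_closed[OF l(1)] xH] isom_in[OF g(1)] by auto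
      have "y x = l (g ((inv\<^bsub>G\<^esub> l) x))"
        using l g(1) xH mem by (simp add: mult_isom_group)
      then have "h x = l (g ((inv\<^bsub>G\<^esub> l) x))" using y(2) x by simp
      then show ?thesis using isom_inv_left[OF l(1) mem(2)] by simp
    qed
    then show ?thesis using isom_inv_closed[OF l(1)] by blast
  qed
  obtain p0 p1 p2 D where p: "p0 \<in> H" "p1 \<in> H" "p2 \<in> H"
    and D: "d p0 p1 = D" "d p1 p2 = D" "d p0 p2 = 2 * D" "D > 2 * \<delta>"
    and cl: "delta_closed \<delta> H d {p0, p1}" "delta_closed \<delta> H d {p1, p2}"
    using translation_points by metis
  \<comment> \<open>The shift by one point along the line, extended to \<open>h\<close> by
    homogeneity.\<close>
  define f where "f x = (if x = p0 then p1 else p2)" for x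
  have ne: "p0 \<noteq> p1" using D p nonneg_delta by auto
  have "f ` {p0, p1} = {p1, p2}" using ne by (auto simp: f_def)
  moreover have "isometric_on {p0, p1} d d f"
    using D p ne commute[of p1 p0] commute[of p2 p1] by (auto simp: isometric_on_def f_def)
  ultimately obtain h where h: "h \<in> carrier G" "\<And>x. x \<in> {p0, p1} \<Longrightarrow> h x = f x"
    using extension[OF _ cl(1), of f] cl(2) by (metis finite.emptyI finite.insertI)
  then have "h p0 = p1" "h p1 = p2" using ne by (auto simp: f_def)
  then obtain k where k: "k \<in> carrier G" "g (k p0) = k p1" "g (k p1) = k p2"
    using meets[OF _ cl(1) h(1)] by auto
  interpret G: group G by (rule group_isom_group)
  \<comment> \<open>Near the identity, agreement on the closed set consisting of \<open>p0\<close>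
    alone gives \<open>g\<close> the fixed point \<open>l p0\<close>, while \<open>g\<close> also
    shifts the \<open>k\<close>-translates of the three points.\<close>
  have "\<one>\<^bsub>G\<^esub> p0 = p0" using p(1) by (simp add: isom_group_def BijGroup_def)
  then obtain l where l: "l \<in> carrier G" "g (l p0) = l p0"
    using meets[OF _ delta_closed_singleton[OF p(1) nonneg_delta] G.one_closed] by auto
  show False
    using translation_no_fixed_point[of "k p0" "k p1" "k p2" D g "l p0"] D k l p g(1)
      isom_in[OF k(1)] isom_in[OF l(1)] isom_dist[OF k(1)] by simp
qed

end

theorem proposition6p7:
  fixes \<delta> :: real and H :: "'a set" and d :: "'a \<Rightarrow> 'a \<Rightarrow> real"
  assumes "\<delta> \<ge> 0"
    and "is_H_delta \<delta> H d"
  shows "\<not> has_dense_conjugacy_class (isom_group H d) (isom_topology \<delta> H d) \<and>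
    (\<forall>B. finite B \<and> B \<noteq> {} \<and> B \<subseteq> H \<longrightarrow>
      has_dense_conjugacy_class
        (isom_group H d \<lparr>carrier := pointwise_stabilizer H d (delta_cl \<delta> H d B)\<rparr>)
        (subtopology (isom_topology \<delta> H d) (pointwise_stabilizer H d (delta_cl \<delta> H d B))))"
proof -
  interpret H_delta \<delta> H d by (rule H_delta.intro[OF assms])
  show ?thesis
    using no_dense_conjugacy_class dense_conjugacy_class_stab[OF delta_cl] by blast
qed

end
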